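(* The universal $R$-matrix of $U_q(\mathfrak{osp}(2|1))$ is given by $$\mathbf R=Q\,\mathcal R,$$ where $Q:=C\,q_*^{\frac{H\otimes H}{2}}$ with $$C:=\tfrac12\left(1\otimes 1+i\xi\eta\otimes 1+1\otimes i\xi\eta+\xi\eta\otimes\xi\eta\right),$$ such that $C\cdot|(-1)^{\epsilon_1}\rangle\otimes|(-1)^{\epsilon_2}\rangle=(-1)^{\epsilon_1\epsilon_2}|(-1)^{\epsilon_1}\rangle\otimes|(-1)^{\epsilon_2}\rangle$ for $\epsilon_1,\epsilon_2\in\{0,1\}$, and $$\mathcal R:=\exp_{q_*^{-2}}\left(i(q_*^{-1}-q_* )\,\mathcal E\otimes\mathcal F\right)=\exp_{-q^{-2}}\left(-(q+q^{-1})\,\mathcal E\otimes\mathcal F\right)=\sum_{n\ge0} a_n\,\mathcal E^n\otimes\mathcal F^n,$$ where $$a_n=(-1)^nq^{\frac12 n(n-1)}\frac{(q+q^{-1})^n}{\{n\}_q!}.$$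
   Context: $q=e^{\pi i b^2}$, $q_*:=-iq=e^{\pi i b_*^2}$ with $b^2=b_*^2+\frac12$. $\{n\}_q=\frac{q^{-n}-(-1)^nq^n}{q+q^{-1}}$, $\{n\}_q!=\prod_{k=1}^n\{k\}_q$. $\lceil n\rceil_p=\frac{1-p^n}{1-p}$, $\lceil n\rceil_p!=\prod_{k=1}^n\lceil k\rceil_p$, $\exp_p(x)=\sum_{n\ge0}\frac{x^n}{\lceil n\rceil_p!}$. $U_q(\mathfrak{osp}(2|1))$ is the Hopf superalgebra generated by an even element $\mathcal K$ (invertible) and odd elements $\mathcal E,\mathcal F$ with $\mathcal E\mathcal F+\mathcal F\mathcal E=\frac{\mathcal K-\mathcal K^{-1}}{q+q^{-1}}$, $\mathcal K\mathcal E=q^2\mathcal E\mathcal K$, $\mathcal K\mathcal F=q^{-2}\mathcal F\mathcal K$, and coproduct $\Delta(\mathcal E)=\mathcal E\otimes\mathcal K+1\otimes\mathcal E$, $\Delta(\mathcal F)=\mathcal F\otimes1+\mathcal K^{-1}\otimes\mathcal F$, $\Delta(\mathcal K)=\mathcal K\otimes\mathcal K$. The odd Clifford generators $\xi,\eta$ satisfy $\xi^2=\eta^2=1$, $\xi\eta=-\eta\xi$ and act on $\mathbb C^{1|1}=\mathrm{span}\{|+\rangle,|-\rangle\}$ ($|+\rangle$ even, $|-\rangle$ odd) by $\xi|\pm\rangle=|\mp\rangle$, $\eta|+\rangle=-i|-\rangle$, $\eta|-\rangle=i|+\rangle$, so that $i\xi\eta|\pm\rangle=\pm|\pm\rangle$;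 $|\pm\rangle$ is also written $|(-1)^\epsilon\rangle$, $\epsilon\in\{0,1\}$. If $E,F,K$ generate $U_{q_*}(\mathfrak{sl}(2))$, where formally $K=q_*^H$, then $\mathcal E=\xi E$, $\mathcal F=\eta F$, $\mathcal K=i\xi\eta K$ generate $U_q(\mathfrak{osp}(2|1))$; the elements $H,\xi,\eta,\mathcal E,\mathcal F$ in the formulas are those of this realization. Tensor products are super tensor products. *)

theory Defs
  imports Complex_Main "HOL-Library.Poly_Mapping"
begin

section \<open>Parameters and quantum numbers\<close>

text \<open>
  Powers of \<open>q = exp (\<pi> \<i> b^2)\<close> with a complex exponent use the logarithm \<open>\<pi> \<i> b^2\<close>.  The same
  functions at \<open>b\<^sub>*\<close> give \<open>q\<^sub>*\<close> and its powers.
\<close>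

definition qpow :: "complex \<Rightarrow> complex \<Rightarrow> complex" where
  "qpow b z = exp (of_real pi * \<i> * b^2 * z)"

definition qpar :: "complex \<Rightarrow> complex" where
  "qpar b = exp (of_real pi * \<i> * b^2)"

definition brace :: "complex \<Rightarrow> nat \<Rightarrow> complex" where
  "brace q n = (inverse q ^ n - (- 1) ^ n * q ^ n) / (q + inverse q)"

definition brace_fact :: "complex \<Rightarrow> nat \<Rightarrow> complex" where
  "brace_fact q n = (\<Prod>k=1..n. brace q k)"

definition qnum :: "complex \<Rightarrow> nat \<Rightarrow> complex" where
  "qnum p n = (1 - p ^ n) / (1 - p)"

definition qnum_fact :: "complex \<Rightarrow> nat \<Rightarrow> complex" where
  "qnum_fact p n = (\<Prod>k=1..n. qnum p k)"

definition a_coeff :: "complex \<Rightarrow> nat \<Rightarrow> complex" where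
  "a_coeff q n =
     (- 1) ^ n * q ^ (n * (n - 1) div 2) * (q + inverse q) ^ n / brace_fact q n"


section \<open>Based complex vector spaces\<close>

text \<open>
  A vector space with a basis indexed by \<open>'i\<close> is the space of finitely supported functions
  \<open>'i \<Rightarrow>\<^sub>0 complex\<close>; the tensor product of two such spaces has basis index type \<open>'i \<times> 'j\<close>.
\<close>

type_synonym 'i vec = "'i \<Rightarrow>\<^sub>0 complex"

definition cscale :: "complex \<Rightarrow> 'i vec \<Rightarrow> 'i vec" where
  "cscale c v = Poly_Mapping.map ((*) c) v"

lemma lookup_cscale: "Poly_Mapping.lookup (cscale c v) i = c * Poly_Mapping.lookup v i"
  by (simp add: cscale_def Poly_Mapping.map.rep_eq when_def)

lemma vector_space_cscale: "vector_space (cscale :: complex \<Rightarrow> 'i vec \<Rightarrow> 'i vec)"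
  by unfold_locales (auto intro!: poly_mapping_eqI simp: lookup_cscale lookup_add algebra_simps)

definition basis_vec :: "'i \<Rightarrow> 'i vec" where
  "basis_vec i = Poly_Mapping.single i 1"

abbreviation clinear_map :: "('i vec \<Rightarrow> 'j vec) \<Rightarrow> bool" where
  "clinear_map T \<equiv> Vector_Spaces.linear cscale cscale T"

definition lin_ext :: "('i \<Rightarrow> 'j vec) \<Rightarrow> 'i vec \<Rightarrow> 'j vec" where
  "lin_ext f v = (\<Sum>i\<in>Poly_Mapping.keys v. cscale (Poly_Mapping.lookup v i) (f i))"

text \<open>Parities are functions on the basis indices; \<open>True\<close> means odd.\<close>

definition even_map :: "('i \<Rightarrow> bool) \<Rightarrow> ('j \<Rightarrow> bool) \<Rightarrow> ('i vec \<Rightarrow> 'j vec) \<Rightarrow> bool" where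
  "even_map p p' T \<longleftrightarrow> (\<forall>i. \<forall>j\<in>Poly_Mapping.keys (T (basis_vec i)). p' j = p i)"

definition odd_map :: "('i \<Rightarrow> bool) \<Rightarrow> ('j \<Rightarrow> bool) \<Rightarrow> ('i vec \<Rightarrow> 'j vec) \<Rightarrow> bool" where
  "odd_map p p' T \<longleftrightarrow> (\<forall>i. \<forall>j\<in>Poly_Mapping.keys (T (basis_vec i)). p' j \<noteq> p i)"

text \<open>
  Super tensor product of linear maps \<open>A\<close> and \<open>B\<close>, with
  \<open>(A \<otimes> B)(v \<otimes> w) = (-1)^(|B| |v|) A v \<otimes> B w\<close>.  The matrix entry of \<open>B\<close> from \<open>j\<close> to \<open>l\<close> belongs to
  the component of \<open>B\<close> of parity \<open>|j| + |l|\<close>, so no homogeneity of \<open>B\<close> has to be assumed.  The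
  arguments \<open>p1\<close>, \<open>p2\<close>, \<open>p3\<close> are the parities of the sources of \<open>A\<close> and \<open>B\<close> and of the target of \<open>B\<close>.
\<close>

definition super_tensor ::
  "('i \<Rightarrow> bool) \<Rightarrow> ('j \<Rightarrow> bool) \<Rightarrow> ('l \<Rightarrow> bool) \<Rightarrow>
   ('i vec \<Rightarrow> 'k vec) \<Rightarrow> ('j vec \<Rightarrow> 'l vec) \<Rightarrow> ('i \<times> 'j) vec \<Rightarrow> ('k \<times> 'l) vec" where
  "super_tensor p1 p2 p3 A B = lin_ext (\<lambda>(i, j).
     \<Sum>k\<in>Poly_Mapping.keys (A (basis_vec i)). \<Sum>l\<in>Poly_Mapping.keys (B (basis_vec j)).
       Poly_Mapping.single (k, l)
         ((if p1 i \<and> p2 j \<noteq> p3 l then - 1 else 1) *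
          Poly_Mapping.lookup (A (basis_vec i)) k * Poly_Mapping.lookup (B (basis_vec j)) l))"

definition super_flip :: "('i \<Rightarrow> bool) \<Rightarrow> ('j \<Rightarrow> bool) \<Rightarrow> ('i \<times> 'j) vec \<Rightarrow> ('j \<times> 'i) vec" where
  "super_flip p1 p2 =
     lin_ext (\<lambda>(i, j). cscale (if p1 i \<and> p2 j then - 1 else 1) (basis_vec (j, i)))"

definition assoc :: "(('i \<times> 'j) \<times> 'k) vec \<Rightarrow> ('i \<times> 'j \<times> 'k) vec" where
  "assoc = lin_ext (\<lambda>((i, j), k). basis_vec (i, j, k))"

definition assoc_inv :: "('i \<times> 'j \<times> 'k) vec \<Rightarrow> (('i \<times> 'j) \<times> 'k) vec" where
  "assoc_inv = lin_ext (\<lambda>(i, j, k). basis_vec ((i, j), k))"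


section \<open>The Clifford algebra and the element C\<close>

text \<open>\<open>|+\<rangle> = basis_vec False\<close> and \<open>|-\<rangle> = basis_vec True\<close>, so that the parity function is \<open>id\<close>.\<close>

definition cliff_xi :: "bool vec \<Rightarrow> bool vec" where
  "cliff_xi = lin_ext (\<lambda>\<epsilon>. basis_vec (\<not> \<epsilon>))"

definition cliff_eta :: "bool vec \<Rightarrow> bool vec" where
  "cliff_eta = lin_ext (\<lambda>\<epsilon>. cscale (if \<epsilon> then \<i> else - \<i>) (basis_vec (\<not> \<epsilon>)))"

text \<open>\<open>X\<close> and \<open>Y\<close> are the operators by which \<open>\<xi>\<eta>\<close> acts on the two factors.\<close>

definition C_op :: "('i \<Rightarrow> bool) \<Rightarrow> ('j \<Rightarrow> bool) \<Rightarrow> ('i vec \<Rightarrow> 'i vec) \<Rightarrow> ('j vec \<Rightarrow> 'j vec) \<Rightarrow>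
    ('i \<times> 'j) vec \<Rightarrow> ('i \<times> 'j) vec" where
  "C_op p1 p2 X Y v = cscale (1/2)
     (super_tensor p1 p2 p2 id id v
      + super_tensor p1 p2 p2 (\<lambda>u. cscale \<i> (X u)) id v
      + super_tensor p1 p2 p2 id (\<lambda>u. cscale \<i> (Y u)) v
      + super_tensor p1 p2 p2 X Y v)"


section \<open>Weight modules\<close>

text \<open>
  Writing \<open>\<K> = q\<^sub>*^H\<close> formally requires modules on which \<open>H\<close> is diagonalizable, and the infinite sum in
  the R-matrix requires the raising generator to be locally nilpotent.  A module is given in a basis
  of parity-homogeneous eigenvectors of \<open>H\<close>; \<open>wt i\<close> is the (arbitrary complex) eigenvalue of
  \<open>basis_vec i\<close>.
\<close>

definition shifts_weight :: "('i \<Rightarrow> complex) \<Rightarrow> ('i vec \<Rightarrow> 'i vec) \<Rightarrow> complex \<Rightarrow> bool" where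
  "shifts_weight wt T d \<longleftrightarrow> (\<forall>i. \<forall>j\<in>Poly_Mapping.keys (T (basis_vec i)). wt j = wt i + d)"

definition locally_nilpotent :: "('i vec \<Rightarrow> 'i vec) \<Rightarrow> bool" where
  "locally_nilpotent T \<longleftrightarrow> (\<forall>v. \<exists>n. (T ^^ n) v = 0)"

text \<open>The action of \<open>q\<^sub>*^(s H)\<close>.\<close>

definition qH :: "complex \<Rightarrow> ('i \<Rightarrow> complex) \<Rightarrow> complex \<Rightarrow> 'i vec \<Rightarrow> 'i vec" where
  "qH bs wt s = lin_ext (\<lambda>i. cscale (qpow bs (s * wt i)) (basis_vec i))"

text \<open>
  Weight modules over \<open>U_{q\<^sub>*}(sl(2))\<close>, with \<open>K = q\<^sub>*^H\<close>.  The weight shifts express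
  \<open>[H, E] = 2 E\<close> and \<open>[H, F] = - 2 F\<close>, the formal versions of \<open>K E = q\<^sub>*^2 E K\<close>, \<open>K F = q\<^sub>*^(-2) F K\<close>.
\<close>

record 'i sl2_module =
  sl_wt :: "'i \<Rightarrow> complex"
  sl_E :: "'i vec \<Rightarrow> 'i vec"
  sl_F :: "'i vec \<Rightarrow> 'i vec"

definition sl2_weight_module :: "complex \<Rightarrow> 'i sl2_module \<Rightarrow> bool" where
  "sl2_weight_module bs V \<longleftrightarrow>
     clinear_map (sl_E V) \<and> clinear_map (sl_F V) \<and>
     shifts_weight (sl_wt V) (sl_E V) 2 \<and> shifts_weight (sl_wt V) (sl_F V) (- 2) \<and>
     (\<forall>v. sl_E V (sl_F V v) - sl_F V (sl_E V v) =
        cscale (1 / (qpar bs - inverse (qpar bs)))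
          (qH bs (sl_wt V) 1 v - qH bs (sl_wt V) (- 1) v)) \<and>
     locally_nilpotent (sl_E V)"

text \<open>
  Weight supermodules over \<open>U_q(osp(2|1))\<close>: \<open>XE\<close>, \<open>EE\<close>, \<open>FF\<close> are the actions of \<open>\<xi>\<eta>\<close>, \<open>\<E>\<close>, \<open>\<F>\<close>.
  Modules not of the form \<open>V \<otimes> \<complex>^(1|1)\<close> are allowed, so that the category is closed under tensor
  products; of the Clifford algebra only \<open>\<xi>\<eta>\<close> acts on them, subject to \<open>(\<xi>\<eta>)^2 = -1\<close> and to
  anticommuting with \<open>\<E> = \<xi> E\<close> and \<open>\<F> = \<eta> F\<close>.
\<close>

record 'i osp_module =
  par :: "'i \<Rightarrow> bool"
  wt :: "'i \<Rightarrow> complex"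
  XE :: "'i vec \<Rightarrow> 'i vec"
  EE :: "'i vec \<Rightarrow> 'i vec"
  FF :: "'i vec \<Rightarrow> 'i vec"

text \<open>\<open>\<K> = \<i> \<xi>\<eta> q\<^sub>*^H\<close> and its inverse \<open>\<i> \<xi>\<eta> q\<^sub>*^(-H)\<close>; note \<open>(\<i> \<xi>\<eta>)^2 = 1\<close>.\<close>

definition KK :: "complex \<Rightarrow> 'i osp_module \<Rightarrow> 'i vec \<Rightarrow> 'i vec" where
  "KK bs M v = cscale \<i> (XE M (qH bs (wt M) 1 v))"

definition KK_inv :: "complex \<Rightarrow> 'i osp_module \<Rightarrow> 'i vec \<Rightarrow> 'i vec" where
  "KK_inv bs M v = cscale \<i> (XE M (qH bs (wt M) (- 1) v))"

definition osp_weight_module :: "complex \<Rightarrow> complex \<Rightarrow> 'i osp_module \<Rightarrow> bool" where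
  "osp_weight_module b bs M \<longleftrightarrow>
     clinear_map (XE M) \<and> clinear_map (EE M) \<and> clinear_map (FF M) \<and>
     even_map (par M) (par M) (XE M) \<and>
     odd_map (par M) (par M) (EE M) \<and> odd_map (par M) (par M) (FF M) \<and>
     shifts_weight (wt M) (XE M) 0 \<and>
     shifts_weight (wt M) (EE M) 2 \<and> shifts_weight (wt M) (FF M) (- 2) \<and>
     (\<forall>v. XE M (XE M v) = - v) \<and>
     (\<forall>v. XE M (EE M v) = - EE M (XE M v)) \<and>
     (\<forall>v. XE M (FF M v) = - FF M (XE M v)) \<and>
     (\<forall>v. EE M (FF M v) + FF M (EE M v) =
        cscale (1 / (qpar b + inverse (qpar b))) (KK bs M v - KK_inv bs M v)) \<and>
     (\<forall>v. KK bs M (EE M v) = cscale ((qpar b)^2) (EE M (KK bs M v))) \<and>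
     (\<forall>v. KK bs M (FF M v) = cscale (inverse ((qpar b)^2)) (FF M (KK bs M v))) \<and>
     locally_nilpotent (EE M)"

text \<open>The realization \<open>\<E> = \<xi> E\<close>, \<open>\<F> = \<eta> F\<close> on \<open>V \<otimes> \<complex>^(1|1)\<close>, with \<open>V\<close> purely even.\<close>

definition realization :: "'i sl2_module \<Rightarrow> ('i \<times> bool) osp_module" where
  "realization V =
     \<lparr> par = snd,
       wt = (\<lambda>(i, \<epsilon>). sl_wt V i),
       XE = super_tensor (\<lambda>_. False) id id id (cliff_xi \<circ> cliff_eta),
       EE = super_tensor (\<lambda>_. False) id id (sl_E V) cliff_xi,
       FF = super_tensor (\<lambda>_. False) id id (sl_F V) cliff_eta \<rparr>"

text \<open>Even maps commuting with \<open>H\<close>, \<open>\<xi>\<eta>\<close>, \<open>\<E>\<close>, \<open>\<F>\<close>.\<close>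

definition osp_hom :: "'i osp_module \<Rightarrow> 'k osp_module \<Rightarrow> ('i vec \<Rightarrow> 'k vec) \<Rightarrow> bool" where
  "osp_hom M M' f \<longleftrightarrow>
     clinear_map f \<and> even_map (par M) (par M') f \<and>
     (\<forall>i. \<forall>k\<in>Poly_Mapping.keys (f (basis_vec i)). wt M' k = wt M i) \<and>
     f \<circ> XE M = XE M' \<circ> f \<and> f \<circ> EE M = EE M' \<circ> f \<and> f \<circ> FF M = FF M' \<circ> f"


section \<open>Coproduct\<close>

abbreviation stensor :: "'i osp_module \<Rightarrow> 'j osp_module \<Rightarrow>
    ('i vec \<Rightarrow> 'i vec) \<Rightarrow> ('j vec \<Rightarrow> 'j vec) \<Rightarrow> ('i \<times> 'j) vec \<Rightarrow> ('i \<times> 'j) vec" where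
  "stensor M N A B \<equiv> super_tensor (par M) (par N) (par N) A B"

text \<open>Expressions denoting the elements of \<open>U_q(osp(2|1))\<close>; \<open>Scal c\<close> stands for \<open>c 1\<close>.\<close>

datatype osp_elem =
    GenE | GenF | GenK | GenKinv
  | Scal complex
  | Plus osp_elem osp_elem
  | Times osp_elem osp_elem

text \<open>\<open>coprod bs M N x\<close> is the operator of \<open>\<Delta>(x)\<close> on \<open>M \<otimes> N\<close>.\<close>

primrec coprod :: "complex \<Rightarrow> 'i osp_module \<Rightarrow> 'j osp_module \<Rightarrow> osp_elem \<Rightarrow>
    ('i \<times> 'j) vec \<Rightarrow> ('i \<times> 'j) vec" where
  "coprod bs M N GenE = (\<lambda>v. stensor M N (EE M) (KK bs N) v + stensor M N id (EE N) v)"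
| "coprod bs M N GenF = (\<lambda>v. stensor M N (FF M) id v + stensor M N (KK_inv bs M) (FF N) v)"
| "coprod bs M N GenK = stensor M N (KK bs M) (KK bs N)"
| "coprod bs M N GenKinv = stensor M N (KK_inv bs M) (KK_inv bs N)"
| "coprod bs M N (Scal c) = cscale c"
| "coprod bs M N (Plus x y) = (\<lambda>v. coprod bs M N x v + coprod bs M N y v)"
| "coprod bs M N (Times x y) = coprod bs M N x \<circ> coprod bs M N y"

text \<open>The opposite coproduct \<open>\<tau> \<circ> \<Delta>\<close>, with \<open>\<tau>\<close> the super flip.\<close>

definition coprod_op :: "complex \<Rightarrow> 'i osp_module \<Rightarrow> 'j osp_module \<Rightarrow> osp_elem \<Rightarrow>
    ('i \<times> 'j) vec \<Rightarrow> ('i \<times> 'j) vec" where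
  "coprod_op bs M N x =
     super_flip (par N) (par M) \<circ> coprod bs N M x \<circ> super_flip (par M) (par N)"

text \<open>
  The module \<open>M \<otimes> N\<close>.  Here \<open>H\<close> is primitive and \<open>\<i> \<xi>\<eta>\<close> is group-like, that is
  \<open>\<Delta>(\<xi>\<eta>) = \<i> \<xi>\<eta> \<otimes> \<xi>\<eta>\<close>, which is the extension compatible with \<open>\<Delta>(\<K>) = \<K> \<otimes> \<K>\<close>, \<open>\<K> = \<i> \<xi>\<eta> q\<^sub>*^H\<close>.
\<close>

definition tensor_module ::
  "complex \<Rightarrow> 'i osp_module \<Rightarrow> 'j osp_module \<Rightarrow> ('i \<times> 'j) osp_module" where
  "tensor_module bs M N =
     \<lparr> par = (\<lambda>(i, j). par M i \<noteq> par N j),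
       wt = (\<lambda>(i, j). wt M i + wt N j),
       XE = (\<lambda>v. cscale \<i> (stensor M N (XE M) (XE N) v)),
       EE = coprod bs M N GenE,
       FF = coprod bs M N GenF \<rparr>"


section \<open>The R-matrix\<close>

text \<open>
  In the two infinite sums below only finitely many terms are nonzero at any given vector when the
  raising generator is locally nilpotent; \<open>Sum_any\<close> is the sum of the nonzero terms.
\<close>

definition qexp :: "complex \<Rightarrow> ('i vec \<Rightarrow> 'i vec) \<Rightarrow> 'i vec \<Rightarrow> 'i vec" where
  "qexp p X v = Sum_any (\<lambda>n. cscale (1 / qnum_fact p n) ((X ^^ n) v))"

definition R_series :: "complex \<Rightarrow> 'i osp_module \<Rightarrow> 'j osp_module \<Rightarrow>
    ('i \<times> 'j) vec \<Rightarrow> ('i \<times> 'j) vec" where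
  "R_series b M N v =
     Sum_any (\<lambda>n. cscale (a_coeff (qpar b) n) (stensor M N (EE M ^^ n) (FF N ^^ n) v))"

definition calR :: "complex \<Rightarrow> 'i osp_module \<Rightarrow> 'j osp_module \<Rightarrow>
    ('i \<times> 'j) vec \<Rightarrow> ('i \<times> 'j) vec" where
  "calR bs M N = qexp (inverse ((qpar bs)^2))
     (\<lambda>v. cscale (\<i> * (inverse (qpar bs) - qpar bs)) (stensor M N (EE M) (FF N) v))"

text \<open>The action of \<open>q\<^sub>*^(H \<otimes> H / 2)\<close>.\<close>

definition qHH :: "complex \<Rightarrow> 'i osp_module \<Rightarrow> 'j osp_module \<Rightarrow>
    ('i \<times> 'j) vec \<Rightarrow> ('i \<times> 'j) vec" where
  "qHH bs M N =
     lin_ext (\<lambda>(i, j). cscale (qpow bs (wt M i * wt N j / 2)) (basis_vec (i, j)))"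

definition Q_op :: "complex \<Rightarrow> 'i osp_module \<Rightarrow> 'j osp_module \<Rightarrow>
    ('i \<times> 'j) vec \<Rightarrow> ('i \<times> 'j) vec" where
  "Q_op bs M N = C_op (par M) (par N) (XE M) (XE N) \<circ> qHH bs M N"

definition R_matrix :: "complex \<Rightarrow> 'i osp_module \<Rightarrow> 'j osp_module \<Rightarrow>
    ('i \<times> 'j) vec \<Rightarrow> ('i \<times> 'j) vec" where
  "R_matrix bs M N = Q_op bs M N \<circ> calR bs M N"


section \<open>Universal R-matrix axioms\<close>

text \<open>
  \<open>R12\<close>, \<open>R13\<close>, \<open>R23\<close> are the embeddings into the threefold tensor product, acting on
  \<open>L \<otimes> M \<otimes> N\<close>, for a given even operator \<open>T\<close> on the two factors concerned.  For
  \<open>T = x \<otimes> y\<close>, conjugation of \<open>x \<otimes> y \<otimes> 1\<close> by the super flip of the last two factors gives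
  \<open>x \<otimes> 1 \<otimes> y\<close>.
\<close>

definition on12 :: "'i osp_module \<Rightarrow> 'j osp_module \<Rightarrow> 'k osp_module \<Rightarrow>
    (('i \<times> 'j) vec \<Rightarrow> ('i \<times> 'j) vec) \<Rightarrow> ('i \<times> 'j \<times> 'k) vec \<Rightarrow> ('i \<times> 'j \<times> 'k) vec" where
  "on12 L M N T =
     assoc \<circ> super_tensor (\<lambda>(i, j). par L i \<noteq> par M j) (par N) (par N) T id \<circ> assoc_inv"

definition on23 :: "'i osp_module \<Rightarrow> 'j osp_module \<Rightarrow> 'k osp_module \<Rightarrow>
    (('j \<times> 'k) vec \<Rightarrow> ('j \<times> 'k) vec) \<Rightarrow> ('i \<times> 'j \<times> 'k) vec \<Rightarrow> ('i \<times> 'j \<times> 'k) vec" where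
  "on23 L M N T =
     super_tensor (par L) (\<lambda>(j, k). par M j \<noteq> par N k) (\<lambda>(j, k). par M j \<noteq> par N k) id T"

definition flip23 :: "'i osp_module \<Rightarrow> 'j osp_module \<Rightarrow> 'k osp_module \<Rightarrow>
    ('i \<times> 'j \<times> 'k) vec \<Rightarrow> ('i \<times> 'k \<times> 'j) vec" where
  "flip23 L M N = super_tensor (par L) (\<lambda>(j, k). par M j \<noteq> par N k)
     (\<lambda>(k, j). par N k \<noteq> par M j) id (super_flip (par M) (par N))"

definition on13 :: "'i osp_module \<Rightarrow> 'j osp_module \<Rightarrow> 'k osp_module \<Rightarrow>
    (('i \<times> 'k) vec \<Rightarrow> ('i \<times> 'k) vec) \<Rightarrow> ('i \<times> 'j \<times> 'k) vec \<Rightarrow> ('i \<times> 'j \<times> 'k) vec" where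
  "on13 L M N T = flip23 L N M \<circ> on12 L N M T \<circ> flip23 L M N"

text \<open>
  An element of the completion of \<open>U \<otimes> U\<close> is a family of operators on the products \<open>M \<otimes> N\<close> which is
  natural in both modules.  Since a formula cannot quantify over index types, the axioms of a
  universal R-matrix are stated at given modules for the members of the family that occur in them:
  \<open>R \<Delta>(x) = \<Delta>\<^sup>o\<^sup>p(x) R\<close> for all \<open>x\<close>, \<open>(\<Delta> \<otimes> id)(R) = R13 R23\<close> and
  \<open>(id \<otimes> \<Delta>)(R) = R13 R12\<close>.  The operators \<open>(\<Delta> \<otimes> id)(R)\<close> and \<open>(id \<otimes> \<Delta>)(R)\<close> are the members at
  \<open>(L \<otimes> M, N)\<close> and \<open>(L, M \<otimes> N)\<close>.
\<close>

definition natural_at :: "'i osp_module \<Rightarrow> 'j osp_module \<Rightarrow> 'k osp_module \<Rightarrow> 'l osp_module \<Rightarrow>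
    (('i \<times> 'j) vec \<Rightarrow> ('i \<times> 'j) vec) \<Rightarrow> (('k \<times> 'l) vec \<Rightarrow> ('k \<times> 'l) vec) \<Rightarrow> bool" where
  "natural_at M N M' N' R R' \<longleftrightarrow>
     (\<forall>f g. osp_hom M M' f \<longrightarrow> osp_hom N N' g \<longrightarrow>
        super_tensor (par M) (par N) (par N') f g \<circ> R
        = R' \<circ> super_tensor (par M) (par N) (par N') f g)"

definition intertwines_coprod :: "complex \<Rightarrow> 'i osp_module \<Rightarrow> 'j osp_module \<Rightarrow>
    (('i \<times> 'j) vec \<Rightarrow> ('i \<times> 'j) vec) \<Rightarrow> bool" where
  "intertwines_coprod bs M N R \<longleftrightarrow>
     (\<forall>x. R \<circ> coprod bs M N x = coprod_op bs M N x \<circ> R)"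

definition invertible_even :: "'i osp_module \<Rightarrow> 'j osp_module \<Rightarrow>
    (('i \<times> 'j) vec \<Rightarrow> ('i \<times> 'j) vec) \<Rightarrow> bool" where
  "invertible_even M N R \<longleftrightarrow>
     clinear_map R \<and> bij R \<and>
     even_map (\<lambda>(i, j). par M i \<noteq> par N j) (\<lambda>(i, j). par M i \<noteq> par N j) R"

definition coprod_id_axiom :: "'i osp_module \<Rightarrow> 'j osp_module \<Rightarrow> 'k osp_module \<Rightarrow>
    ((('i \<times> 'j) \<times> 'k) vec \<Rightarrow> (('i \<times> 'j) \<times> 'k) vec) \<Rightarrow>
    (('i \<times> 'k) vec \<Rightarrow> ('i \<times> 'k) vec) \<Rightarrow> (('j \<times> 'k) vec \<Rightarrow> ('j \<times> 'k) vec) \<Rightarrow> bool" where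
  "coprod_id_axiom L M N R_LM_N R_L_N R_M_N \<longleftrightarrow>
     assoc \<circ> R_LM_N \<circ> assoc_inv = on13 L M N R_L_N \<circ> on23 L M N R_M_N"

definition id_coprod_axiom :: "'i osp_module \<Rightarrow> 'j osp_module \<Rightarrow> 'k osp_module \<Rightarrow>
    (('i \<times> 'j \<times> 'k) vec \<Rightarrow> ('i \<times> 'j \<times> 'k) vec) \<Rightarrow>
    (('i \<times> 'k) vec \<Rightarrow> ('i \<times> 'k) vec) \<Rightarrow> (('i \<times> 'j) vec \<Rightarrow> ('i \<times> 'j) vec) \<Rightarrow> bool" where
  "id_coprod_axiom L M N R_L_MN R_L_N R_L_M \<longleftrightarrow>
     R_L_MN = on13 L M N R_L_N \<circ> on12 L M N R_L_M"

end

theory Submission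
  imports Defs
begin

text \<open>
  With the parity operator \<open>\<sigma>\<close> a super tensor product is an ordinary one, \<open>A \<otimes> B\<close> for even \<open>B\<close> and
  \<open>A \<sigma> \<otimes> B\<close> for odd \<open>B\<close>, so every identity can be checked on pure tensors.  Three facts about the
  q-exponential at \<open>p = - q\<^sup>-\<^sup>2\<close> then suffice, with \<open>Y = - (q + q\<^sup>-\<^sup>1) \<E> \<otimes> \<F>\<close>.

  Intertwining: if \<open>Y f = f Y + e' - e\<close>, \<open>e Y = p Y e\<close> and \<open>Y e' = p e' Y\<close>, then
  \<open>exp\<^sub>p(Y) (f + e) = (f + e') exp\<^sub>p(Y)\<close>.  This moves \<open>\<Delta>(\<E>)\<close> and \<open>\<Delta>(\<F>)\<close> past the quasi-R-matrix, and
  conjugation by \<open>Q\<close>, for which \<open>Q (\<E> \<otimes> 1) = (\<E> \<otimes> \<K>) Q\<close> and so on, turns the result into the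
  opposite coproduct.

  Addition: \<open>exp\<^sub>p(A + B) = exp\<^sub>p(A) exp\<^sub>p(B)\<close> if \<open>B A = p A B\<close>.  The two summands of the coproduct
  of \<open>\<E>\<close> (or of \<open>\<F>\<close>) give such \<open>A\<close> and \<open>B\<close> in the threefold tensor product, and \<open>A\<close> is the
  conjugate of \<open>Y\<^sub>1\<^sub>3\<close> by \<open>Q\<^sub>2\<^sub>3\<close> (or by \<open>Q\<^sub>1\<^sub>2\<close>).

  Naturality: a linear map that carries \<open>Y\<close> to \<open>Y'\<close> carries \<open>exp\<^sub>p(Y)\<close> to \<open>exp\<^sub>p(Y')\<close>.
\<close>

section \<open>Linear maps of based vector spaces\<close>

interpretation vec: vector_space "cscale :: complex \<Rightarrow> 'i vec \<Rightarrow> 'i vec"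
  by (rule vector_space_cscale)

lemmas lookup_vec = lookup_add lookup_minus lookup_cscale lookup_uminus lookup_zero

lemma vec_eqI:
  fixes u v :: "'i vec"
  assumes "\<And>k. Poly_Mapping.lookup u k = Poly_Mapping.lookup v k"
  shows "u = v"
  using assms by (rule poly_mapping_eqI)

lemma clinear_map_iff:
  "clinear_map T \<longleftrightarrow> (\<forall>u v. T (u + v) = T u + T v) \<and> (\<forall>c v. T (cscale c v) = cscale c (T v))"
proof
  assume "clinear_map T"
  then interpret Vector_Spaces.linear cscale cscale T .
  show "(\<forall>u v. T (u + v) = T u + T v) \<and> (\<forall>c v. T (cscale c v) = cscale c (T v))"
    by (simp add: add scale)
next
  assume "(\<forall>u v. T (u + v) = T u + T v) \<and> (\<forall>c v. T (cscale c v) = cscale c (T v))"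
  then show "clinear_map T"
    by unfold_locales simp_all
qed

lemma clinear_map_simps:
  assumes "clinear_map T"
  shows "T (u + v) = T u + T v" "T (cscale c v) = cscale c (T v)" "T 0 = 0"
    "T (- v) = - T v" "T (u - v) = T u - T v"
proof -
  interpret Vector_Spaces.linear cscale cscale T by fact
  show "T (u + v) = T u + T v" "T (cscale c v) = cscale c (T v)" "T 0 = 0"
    "T (- v) = - T v" "T (u - v) = T u - T v"
    by (simp_all add: add scale neg diff)
qed

lemma clinear_map_sum:
  assumes "clinear_map T"
  shows "T (\<Sum>i\<in>I. f i) = (\<Sum>i\<in>I. T (f i))"
proof -
  interpret Vector_Spaces.linear cscale cscale T by fact
  show ?thesis by (rule sum)
qed

lemma clinear_map_id [simp]: "clinear_map id" "clinear_map (\<lambda>v. v)"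
  by (simp_all add: clinear_map_iff)

lemma clinear_map_comp [simp]: "clinear_map S \<Longrightarrow> clinear_map T \<Longrightarrow> clinear_map (S \<circ> T)"
  by (simp add: clinear_map_iff)

lemma clinear_map_cscale [simp]: "clinear_map T \<Longrightarrow> clinear_map (\<lambda>v. cscale c (T v))"
  by (simp add: clinear_map_iff vec.scale_right_distrib vec.scale_left_commute)

lemma clinear_map_add [simp]:
  "clinear_map S \<Longrightarrow> clinear_map T \<Longrightarrow> clinear_map (\<lambda>v. S v + T v)"
  by (simp add: clinear_map_iff vec.scale_right_distrib algebra_simps)

lemma clinear_map_funpow [simp]:
  fixes T :: "'i vec \<Rightarrow> 'i vec"
  shows "clinear_map T \<Longrightarrow> clinear_map (T ^^ n)"
  by (induction n) (simp_all add: clinear_map_iff)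

lemma lookup_basis_vec: "Poly_Mapping.lookup (basis_vec i) j = (if i = j then 1 else 0)"
  by (simp add: basis_vec_def lookup_single when_def)

lemma lookup_sum_vec:
  "Poly_Mapping.lookup (\<Sum>i\<in>I. f i) k = (\<Sum>i\<in>I. Poly_Mapping.lookup (f i) k)"
  by (rule lookup_sum)

text \<open>Coefficients outside the support vanish, so sums over the supports of different vectors
  can be compared over one common finite set.\<close>

lemma lin_ext_eq_sum:
  assumes "finite A" "Poly_Mapping.keys v \<subseteq> A"
  shows "lin_ext f v = (\<Sum>i\<in>A. cscale (Poly_Mapping.lookup v i) (f i))"
  unfolding lin_ext_def using assms
  by (intro sum.mono_neutral_left) (auto simp: in_keys_iff)

lemma clinear_lin_ext [simp]: "clinear_map (lin_ext f)"
  unfolding clinear_map_iff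
proof (intro conjI allI)
  fix u v :: "'a vec" and c
  let ?A = "Poly_Mapping.keys u \<union> Poly_Mapping.keys v"
  have *: "finite ?A" "Poly_Mapping.keys u \<subseteq> ?A" "Poly_Mapping.keys v \<subseteq> ?A"
    "Poly_Mapping.keys (u + v) \<subseteq> ?A"
    using keys_add[of u v] by auto
  show "lin_ext f (u + v) = lin_ext f u + lin_ext f v"
    unfolding lin_ext_eq_sum[OF *(1,2)] lin_ext_eq_sum[OF *(1,3)] lin_ext_eq_sum[OF *(1,4)]
    by (simp add: lookup_add vec.scale_left_distrib sum.distrib)
  have "Poly_Mapping.keys (cscale c v) \<subseteq> Poly_Mapping.keys v"
    by (auto simp: in_keys_iff lookup_cscale)
  then show "lin_ext f (cscale c v) = cscale c (lin_ext f v)"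
    by (subst lin_ext_eq_sum[of "Poly_Mapping.keys v"])
       (simp_all add: lin_ext_def lookup_cscale vec.scale_sum_right)
qed

lemma lin_ext_basis_vec [simp]: "lin_ext f (basis_vec i) = f i"
  by (simp add: lin_ext_def basis_vec_def)

lemma vec_eq_sum_basis_vec:
  "v = (\<Sum>i\<in>Poly_Mapping.keys v. cscale (Poly_Mapping.lookup v i) (basis_vec i))"
proof (rule vec_eqI)
  fix k
  have "(\<Sum>i\<in>Poly_Mapping.keys v. Poly_Mapping.lookup (cscale (Poly_Mapping.lookup v i) (basis_vec
      i)) k)
      = (\<Sum>i\<in>Poly_Mapping.keys v. if i = k then Poly_Mapping.lookup v k else 0)"
    by (intro sum.cong) (auto simp: lookup_cscale lookup_basis_vec)
  also have "\<dots> = Poly_Mapping.lookup v k"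
    by (simp add: in_keys_iff)
  finally show "Poly_Mapping.lookup v k = Poly_Mapping.lookup
     (\<Sum>i\<in>Poly_Mapping.keys v. cscale (Poly_Mapping.lookup v i) (basis_vec i)) k"
    by (simp add: lookup_sum_vec)
qed

lemma clinear_map_basis_ext:
  assumes "clinear_map S" "clinear_map T" "\<And>i. S (basis_vec i) = T (basis_vec i)"
  shows "S = T"
proof
  fix v
  show "S v = T v"
    by (subst (1 2) vec_eq_sum_basis_vec)
       (simp add: assms clinear_map_sum clinear_map_simps(2)[OF assms(1)] clinear_map_simps(2)[OF
           assms(2)])
qed

lemma vec_basis_induct [consumes 0, case_names zero add scale basis]:
  assumes "P 0" "\<And>u v. P u \<Longrightarrow> P v \<Longrightarrow> P (u + v)" "\<And>c v. P v \<Longrightarrow> P (cscale c v)"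
    "\<And>i. P (basis_vec i)"
  shows "P v"
proof -
  have "P (\<Sum>i\<in>A. cscale (f i) (basis_vec i))" if "finite A" for A f
    using that by induction (auto intro: assms)
  then show ?thesis
    by (subst vec_eq_sum_basis_vec) simp
qed

section \<open>Diagonal operators\<close>

text \<open>The parity operators, the powers \<open>qH\<close> and the Cartan factor
  \<open>qHH\<close> are all of this form.\<close>

definition diag :: "('i \<Rightarrow> complex) \<Rightarrow> 'i vec \<Rightarrow> 'i vec" where
  "diag f = lin_ext (\<lambda>i. cscale (f i) (basis_vec i))"

lemma clinear_diag [simp]: "clinear_map (diag f)"
  by (simp add: diag_def)

lemmas diag_simps [simp] = clinear_map_simps[OF clinear_diag]

lemma diag_basis_vec [simp]: "diag f (basis_vec i) = cscale (f i) (basis_vec i)"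
  by (simp add: diag_def)

lemma lookup_diag: "Poly_Mapping.lookup (diag f v) k = f k * Poly_Mapping.lookup v k"
  by (induction v rule: vec_basis_induct)
     (simp_all add: lookup_vec lookup_basis_vec algebra_simps)

lemma diag_diag: "diag f (diag g v) = diag (\<lambda>i. f i * g i) v"
  by (rule vec_eqI) (simp add: lookup_diag)

lemma diag_one: "diag (\<lambda>i. 1) v = v"
  by (rule vec_eqI) (simp add: lookup_diag)

text \<open>Compared coefficientwise, the operator identity says that a nonzero matrix entry from
  \<open>i\<close> to \<open>j\<close> forces \<open>f j = g i\<close>. Conditions on the supports
  of images, such as evenness or a weight shift, thereby become operator identities, which can be
  tested on pure tensors.\<close>

lemma diag_intertwine_iff:
  assumes "clinear_map T"
  shows "(\<forall>i. \<forall>j\<in>Poly_Mapping.keys (T (basis_vec i)). f j = g i) \<longleftrightarrow> (\<forall>v. diag f (T v) = T (diag g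
      v))"
proof
  assume *: "\<forall>i. \<forall>j\<in>Poly_Mapping.keys (T (basis_vec i)). f j = g i"
  have "diag f \<circ> T = T \<circ> diag g"
  proof (rule clinear_map_basis_ext)
    fix i
    have "f k * Poly_Mapping.lookup (T (basis_vec i)) k
        = g i * Poly_Mapping.lookup (T (basis_vec i)) k" for k
      using * by (cases "k \<in> Poly_Mapping.keys (T (basis_vec i))") (auto simp: in_keys_iff)
    then show "(diag f \<circ> T) (basis_vec i) = (T \<circ> diag g) (basis_vec i)"
      by (auto intro!: vec_eqI simp: clinear_map_simps[OF assms] lookup_diag lookup_cscale)
  qed (simp_all add: assms)
  then show "\<forall>v. diag f (T v) = T (diag g v)"
    by (simp add: fun_eq_iff)
next
  assume *: "\<forall>v. diag f (T v) = T (diag g v)"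
  have "f k * Poly_Mapping.lookup (T (basis_vec i)) k
      = g i * Poly_Mapping.lookup (T (basis_vec i)) k" for i k
    using arg_cong[OF *[rule_format, of "basis_vec i"], of "\<lambda>x. Poly_Mapping.lookup x k"]
    by (simp add: clinear_map_simps[OF assms] lookup_diag lookup_cscale)
  then show "\<forall>i. \<forall>j\<in>Poly_Mapping.keys (T (basis_vec i)). f j = g i"
    by (auto simp: in_keys_iff)
qed

text \<open>The parity operator \<sigma>; even maps commute and odd maps anticommute with
  it.\<close>

definition sg :: "('i \<Rightarrow> bool) \<Rightarrow> 'i vec \<Rightarrow> 'i vec" where
  "sg p = diag (\<lambda>i. if p i then - 1 else 1)"

lemma clinear_sg [simp]: "clinear_map (sg p)"
  by (simp add: sg_def)

lemmas sg_simps [simp] = clinear_map_simps[OF clinear_sg]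

lemma sg_sg [simp]: "sg p (sg p v) = v"
  by (rule vec_eqI) (simp add: sg_def lookup_diag)

lemma sg_basis_vec: "sg p (basis_vec i) = cscale (if p i then - 1 else 1) (basis_vec i)"
  by (simp add: sg_def)

lemma sg_even: "sg (\<lambda>_. False) = id"
  by (simp add: sg_def diag_one fun_eq_iff)

lemma diag_uminus: "diag (\<lambda>i. - f i) v = - diag f v"
  by (rule vec_eqI) (simp add: lookup_diag lookup_vec)

lemma even_map_iff:
  assumes "clinear_map T"
  shows "even_map p p' T \<longleftrightarrow> (\<forall>v. sg p' (T v) = T (sg p v))"
  unfolding sg_def diag_intertwine_iff[OF assms, symmetric] even_map_def
  by (simp add: if_split) metis

lemma odd_map_iff:
  assumes "clinear_map T"
  shows "odd_map p p' T \<longleftrightarrow> (\<forall>v. sg p' (T v) = - T (sg p v))"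
proof -
  \<comment> \<open>The sign is moved into the diagonal on the right, which gives the shape of
    \<open>diag_intertwine_iff\<close>.\<close>
  have "(\<forall>v. sg p' (T v) = - T (sg p v)) \<longleftrightarrow>
    (\<forall>v. diag (\<lambda>i. if p' i then - 1 else 1) (T v) = T (diag (\<lambda>i. - (if p i then - 1 else 1)) v))"
    unfolding diag_uminus by (simp add: sg_def clinear_map_simps[OF assms])
  then show ?thesis
    unfolding odd_map_def diag_intertwine_iff[OF assms, symmetric]
    by (simp add: if_split) metis
qed

text \<open>With \<open>diag h\<close> in the role of \<open>H\<close>, this is the commutator
  relation \<open>[H, T] = d T\<close>.\<close>

lemma shifts_weight_iff:
  assumes "clinear_map T"
  shows "shifts_weight h T d \<longleftrightarrow> (\<forall>v. diag h (T v) = T (diag h v) + cscale d (T v))"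
proof -
  have "diag (\<lambda>i. h i + d) v = diag h v + cscale d v" for v
    by (rule vec_eqI) (simp add: lookup_diag lookup_vec algebra_simps)
  then show ?thesis
    unfolding shifts_weight_def diag_intertwine_iff[OF assms]
    by (simp add: clinear_map_simps[OF assms])
qed

section \<open>Tensor products\<close>

definition tens :: "'i vec \<Rightarrow> 'j vec \<Rightarrow> ('i \<times> 'j) vec" where
  "tens v w = lin_ext (\<lambda>i. lin_ext (\<lambda>j. basis_vec (i, j)) w) v"

lemma tens_basis_vec: "tens (basis_vec i) (basis_vec j) = basis_vec (i, j)"
  by (simp add: tens_def)

lemma clinear_tens_left: "clinear_map (\<lambda>v. tens v w)"
  by (simp add: tens_def eta_contract_eq)

lemma lin_ext_fun_add: "lin_ext (\<lambda>i. f i + g i) v = lin_ext f v + lin_ext g v"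
  by (simp add: lin_ext_def vec.scale_right_distrib sum.distrib)

lemma lin_ext_fun_cscale: "lin_ext (\<lambda>i. cscale c (f i)) v = cscale c (lin_ext f v)"
  by (simp add: lin_ext_def vec.scale_sum_right mult.commute)

lemma clinear_tens_right: "clinear_map (tens v)"
  by (simp add: clinear_map_iff tens_def clinear_map_simps[OF clinear_lin_ext]
      lin_ext_fun_add lin_ext_fun_cscale)

lemmas tens_simps [simp] =
  clinear_map_simps[OF clinear_tens_left] clinear_map_simps[OF clinear_tens_right]

lemma lookup_tens:
  "Poly_Mapping.lookup (tens v w) (i, j) = Poly_Mapping.lookup v i * Poly_Mapping.lookup w j"
proof (induction v rule: vec_basis_induct)
  case (basis k)
  show ?case
    by (induction w rule: vec_basis_induct)
       (auto simp: lookup_vec lookup_basis_vec tens_basis_vec algebra_simps)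
qed (simp_all add: lookup_vec algebra_simps)

text \<open>The tensor product without signs; the signs of super tensor products are absorbed into
  parity operators.\<close>

definition tmap :: "('i vec \<Rightarrow> 'k vec) \<Rightarrow> ('j vec \<Rightarrow> 'l vec) \<Rightarrow> ('i \<times> 'j) vec \<Rightarrow> ('k \<times> 'l) vec" where
  "tmap A B = lin_ext (\<lambda>(i, j). tens (A (basis_vec i)) (B (basis_vec j)))"

lemma clinear_tmap [simp]: "clinear_map (tmap A B)"
  by (simp add: tmap_def)

lemmas tmap_simps [simp] = clinear_map_simps[OF clinear_tmap]

lemma tmap_tens [simp]:
  assumes "clinear_map A" "clinear_map B"
  shows "tmap A B (tens v w) = tens (A v) (B w)"
proof -
  note [simp] = clinear_map_simps[OF assms(1)] clinear_map_simps[OF assms(2)]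
  show ?thesis
  proof (induction v rule: vec_basis_induct)
    case (basis k)
    show ?case
      by (induction w rule: vec_basis_induct) (simp_all add: tens_basis_vec, simp add: tmap_def)
  qed simp_all
qed

text \<open>Basis vectors of a product are pure tensors. Relations between operators on products are
  verified below through this rule, by simplification on pure tensors.\<close>

lemma tens_ext:
  assumes "clinear_map S" "clinear_map T" "\<And>v w. S (tens v w) = T (tens v w)"
  shows "S = T"
proof (rule clinear_map_basis_ext[OF assms(1,2)])
  fix x :: "'a \<times> 'b"
  show "S (basis_vec x) = T (basis_vec x)"
    by (cases x) (simp add: assms(3) flip: tens_basis_vec)
qed

lemma tens3_ext:
  assumes "clinear_map S" "clinear_map T" "\<And>u v w. S (tens u (tens v w)) = T (tens u (tens v w))"
  shows "S = T"
proof (rule clinear_map_basis_ext[OF assms(1,2)])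
  fix x :: "'a \<times> 'b \<times> 'c"
  show "S (basis_vec x) = T (basis_vec x)"
    by (cases x) (simp add: assms(3) flip: tens_basis_vec)
qed

lemma tmap_comp:
  assumes "clinear_map A" "clinear_map B" "clinear_map A'" "clinear_map B'"
  shows "tmap A B (tmap A' B' v) = tmap (A \<circ> A') (B \<circ> B') v"
proof -
  have "tmap A B \<circ> tmap A' B' = tmap (A \<circ> A') (B \<circ> B')"
    by (rule tens_ext) (simp_all add: assms)
  then show ?thesis by (simp add: fun_eq_iff)
qed

lemma tmap_id [simp]: "tmap id id = id"
  by (rule tens_ext) simp_all

lemma diag_tens_sep: "diag (\<lambda>(i, j). f i * g j) = tmap (diag f) (diag g)"
  by (rule clinear_map_basis_ext) (auto simp: mult.commute simp flip: tens_basis_vec)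

lemma diag_tens_add: "diag (\<lambda>(i, j). f i + g j) v = tmap (diag f) id v + tmap id (diag g) v"
proof -
  have "diag (\<lambda>(i, j). f i + g j) = (\<lambda>v. tmap (diag f) id v + tmap id (diag g) v)"
    by (rule clinear_map_basis_ext)
       (auto simp: vec.scale_left_distrib simp flip: tens_basis_vec)
  then show ?thesis by simp
qed

lemma sg_tens: "sg (\<lambda>(i, j). p i \<noteq> p' j) = tmap (sg p) (sg p')"
  unfolding sg_def diag_tens_sep[symmetric]
  by (intro arg_cong[of _ _ diag]) auto

section \<open>Super tensor products expressed by ordinary ones\<close>

lemma sum_sum_single_tens:
  "(\<Sum>k\<in>Poly_Mapping.keys u. \<Sum>l\<in>Poly_Mapping.keys w.
      Poly_Mapping.single (k, l) (s l * Poly_Mapping.lookup u k * Poly_Mapping.lookup w l))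
   = tens u (diag s w)" for u :: "'i vec" and w :: "'j vec"
proof (rule vec_eqI)
  fix x :: "'i \<times> 'j"
  obtain i j where x: "x = (i, j)" by force
  have "(\<Sum>k\<in>Poly_Mapping.keys u. \<Sum>l\<in>Poly_Mapping.keys w.
      Poly_Mapping.lookup (Poly_Mapping.single (k, l) (s l * Poly_Mapping.lookup u k *
          Poly_Mapping.lookup w l)) (i, j))
     = (\<Sum>k\<in>Poly_Mapping.keys u. if k = i then \<Sum>l\<in>Poly_Mapping.keys w.
          if l = j then s j * Poly_Mapping.lookup u i * Poly_Mapping.lookup w j else 0 else 0)"
    by (intro sum.cong refl) (auto intro!: sum.cong sum.neutral simp: lookup_single when_def)
  also have "\<dots> = s j * Poly_Mapping.lookup u i * Poly_Mapping.lookup w j"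
    by (auto simp: in_keys_iff)
  finally show "Poly_Mapping.lookup (\<Sum>k\<in>Poly_Mapping.keys u. \<Sum>l\<in>Poly_Mapping.keys w.
      Poly_Mapping.single (k, l) (s l * Poly_Mapping.lookup u k * Poly_Mapping.lookup w l)) x
     = Poly_Mapping.lookup (tens u (diag s w)) x"
    by (simp add: x lookup_sum_vec lookup_tens lookup_diag)
qed

text \<open>For fixed \<open>i\<close> and \<open>j\<close> the sign depends only on the target
  index \<open>l\<close>, so it is a diagonal operator on the second factor.\<close>

lemma super_tensor_eq_lin_ext:
  "super_tensor p1 p2 p3 A B =
     lin_ext (\<lambda>(i, j). tens (A (basis_vec i))
        (diag (\<lambda>l. if p1 i \<and> p2 j \<noteq> p3 l then - 1 else 1) (B (basis_vec j))))"
  unfolding super_tensor_def by (intro arg_cong[of _ _ lin_ext]) (auto simp: fun_eq_iff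
      sum_sum_single_tens)

lemma clinear_super_tensor [simp]: "clinear_map (super_tensor p1 p2 p3 A B)"
  by (simp add: super_tensor_eq_lin_ext)

lemma diag_eqI_keys:
  assumes "\<And>k. k \<in> Poly_Mapping.keys v \<Longrightarrow> f k = c"
  shows "diag f v = cscale c v"
proof (rule vec_eqI)
  fix k
  show "Poly_Mapping.lookup (diag f v) k = Poly_Mapping.lookup (cscale c v) k"
    using assms[of k] by (cases "k \<in> Poly_Mapping.keys v") (auto simp: lookup_diag lookup_cscale
        in_keys_iff)
qed

lemma super_tensor_even:
  assumes "even_map p2 p3 B"
  shows "super_tensor p1 p2 p3 A B = tmap A B"
proof -
  have "diag (\<lambda>l. if p1 i \<and> p2 j \<noteq> p3 l then - 1 else 1) (B (basis_vec j)) = B (basis_vec j)" for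
      i j
    using assms by (subst diag_eqI_keys[where c = 1]) (auto simp: even_map_def)
  then show ?thesis
    by (simp add: super_tensor_eq_lin_ext tmap_def)
qed

lemma super_tensor_odd:
  assumes "odd_map p2 p3 B" "clinear_map A"
  shows "super_tensor p1 p2 p3 A B = tmap (A \<circ> sg p1) B"
proof -
  have "diag (\<lambda>l. if p1 i \<and> p2 j \<noteq> p3 l then - 1 else 1) (B (basis_vec j))
      = cscale (if p1 i then - 1 else 1) (B (basis_vec j))" for i j
    using assms by (intro diag_eqI_keys) (auto simp: odd_map_def)
  then show ?thesis
    by (simp add: super_tensor_eq_lin_ext tmap_def sg_basis_vec clinear_map_simps[OF assms(2)])
qed

lemma super_tensor_trivial_parity: "super_tensor (\<lambda>_. False) p2 p3 A B = tmap A B"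
  by (simp add: super_tensor_eq_lin_ext tmap_def diag_one)

section \<open>The super flip\<close>

lemma clinear_super_flip [simp]: "clinear_map (super_flip p1 p2)"
  by (simp add: super_flip_def)

lemmas super_flip_simps [simp] = clinear_map_simps[OF clinear_super_flip]

lemma super_flip_basis_vec:
  "super_flip p1 p2 (basis_vec (i, j)) = cscale (if p1 i \<and> p2 j then - 1 else 1) (basis_vec (j, i))"
  by (simp add: super_flip_def)

text \<open>
  The sign of two parities is \<open>(1 + \<sigma>\<^sub>1 + \<sigma>\<^sub>2 - \<sigma>\<^sub>1 \<sigma>\<^sub>2) / 2\<close>, which makes the flip computable on
      tensors of
  vectors that are not homogeneous.  The element \<open>C\<close> has the same form.
\<close>

lemma super_flip_tens:
  "super_flip p1 p2 (tens v w) =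
     cscale (1/2) (tens w v + tens w (sg p1 v) + tens (sg p2 w) v - tens (sg p2 w) (sg p1 v))"
proof (induction v rule: vec_basis_induct)
  case (add u v)
  then show ?case
    unfolding tens_simps sg_simps super_flip_simps
    by (simp only:) (rule vec_eqI, simp add: lookup_vec algebra_simps)
next
  case (scale c v)
  then show ?case
    unfolding tens_simps sg_simps super_flip_simps
    by (simp only:) (rule vec_eqI, simp add: lookup_vec algebra_simps)
next
  case (basis k)
  show ?case
  proof (induction w rule: vec_basis_induct)
    case (add u v)
    then show ?case
      unfolding tens_simps sg_simps super_flip_simps
      by (simp only:) (rule vec_eqI, simp add: lookup_vec algebra_simps)
  next
    case (scale c v)
    then show ?case
      unfolding tens_simps sg_simps super_flip_simps
      by (simp only:) (rule vec_eqI, simp add: lookup_vec algebra_simps)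
  next
    case (basis l)
    show ?case
      by (rule vec_eqI) (auto simp: tens_basis_vec super_flip_basis_vec sg_basis_vec lookup_vec)
  qed simp
qed simp

lemma super_flip_super_flip [simp]: "super_flip p2 p1 (super_flip p1 p2 v) = v"
proof -
  have "super_flip p2 p1 \<circ> super_flip p1 p2 = id"
    by (rule clinear_map_basis_ext)
       (auto simp: super_flip_basis_vec)
  then show ?thesis by (simp add: fun_eq_iff)
qed

section \<open>Reassociation of threefold tensor products\<close>

lemma clinear_assoc [simp]: "clinear_map assoc" "clinear_map assoc_inv"
  by (simp_all add: assoc_def assoc_inv_def)

lemmas assoc_simps [simp] = clinear_map_simps[OF clinear_assoc(1)] clinear_map_simps[OF
    clinear_assoc(2)]

lemma assoc_tens [simp]: "assoc (tens (tens u v) w) = tens u (tens v w)"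
proof (induction u rule: vec_basis_induct)
  case (basis i)
  show ?case
  proof (induction v rule: vec_basis_induct)
    case (basis j)
    show ?case
      by (induction w rule: vec_basis_induct) (simp_all add: tens_basis_vec, simp add: assoc_def)
  qed simp_all
qed simp_all

lemma assoc_inv_tens [simp]: "assoc_inv (tens u (tens v w)) = tens (tens u v) w"
proof (induction u rule: vec_basis_induct)
  case (basis i)
  show ?case
  proof (induction v rule: vec_basis_induct)
    case (basis j)
    show ?case
      by (induction w rule: vec_basis_induct) (simp_all add: tens_basis_vec, simp add:
          assoc_inv_def)
  qed simp_all
qed simp_all

lemma assoc_inverse [simp]: "assoc (assoc_inv v) = v" "assoc_inv (assoc w) = w"
proof -
  have "assoc \<circ> assoc_inv = id" "assoc_inv \<circ> assoc = id"
    by (rule clinear_map_basis_ext; auto simp flip: tens_basis_vec)+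
  then show "assoc (assoc_inv v) = v" "assoc_inv (assoc w) = w"
    by (metis comp_apply id_apply)+
qed

section \<open>Series in locally nilpotent operators\<close>

lemma Sum_any_eq_sum_lessThan:
  fixes g :: "nat \<Rightarrow> 'a::comm_monoid_add"
  assumes "\<And>n. n \<ge> N \<Longrightarrow> g n = 0"
  shows "Sum_any g = (\<Sum>n<N. g n)"
proof (rule Sum_any.expand_superset)
  show "{n. g n \<noteq> 0} \<subseteq> {..<N}"
    using assms by (auto simp: not_less[symmetric])
qed simp

lemma funpow_eq_0_mono:
  fixes T :: "'i vec \<Rightarrow> 'i vec"
  assumes "clinear_map T" "(T ^^ n) v = 0" "n \<le> m"
  shows "(T ^^ m) v = 0"
proof -
  have "(T ^^ m) v = (T ^^ (m - n)) ((T ^^ n) v)"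
    using assms(3) by (simp flip: funpow_add[unfolded o_def, THEN fun_cong])
  then show ?thesis
    by (simp add: assms clinear_map_simps[OF clinear_map_funpow[OF assms(1)]])
qed

text \<open>One bound serves finitely many vectors, so that series at related vectors can be
  truncated at the same place.\<close>

lemma locally_nilpotentD:
  assumes "locally_nilpotent T" "clinear_map T" "finite V"
  obtains N where "\<And>n v. n \<ge> N \<Longrightarrow> v \<in> V \<Longrightarrow> (T ^^ n) v = 0"
proof -
  have "\<exists>N. \<forall>n\<ge>N. \<forall>v\<in>V. (T ^^ n) v = 0"
    using assms(3)
  proof induction
    case (insert u V)
    then obtain N where N: "\<forall>n\<ge>N. \<forall>v\<in>V. (T ^^ n) v = 0" by blast
    obtain M where "(T ^^ M) u = 0" using assms(1) by (auto simp: locally_nilpotent_def)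
    then have "\<forall>n\<ge>max M N. \<forall>v\<in>insert u V. (T ^^ n) v = 0"
      using N funpow_eq_0_mono[OF assms(2)] by auto
    then show ?case ..
  qed simp
  then show ?thesis using that by blast
qed

lemma locally_nilpotentD1:
  assumes "locally_nilpotent T" "clinear_map T"
  obtains N where "\<And>n. n \<ge> N \<Longrightarrow> (T ^^ n) v = 0"
  using locally_nilpotentD[OF assms, of "{v}"] by (metis finite.simps singletonI)

lemma locally_nilpotent_basis:
  assumes "clinear_map T" "\<And>i. \<exists>n. (T ^^ n) (basis_vec i) = 0"
  shows "locally_nilpotent T"
  unfolding locally_nilpotent_def
proof
  fix v
  note [simp] = clinear_map_simps[OF clinear_map_funpow[OF assms(1)]]
  show "\<exists>n. (T ^^ n) v = 0"
  proof (induction v rule: vec_basis_induct)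
    case (add u v)
    then obtain m n where "(T ^^ m) u = 0" "(T ^^ n) v = 0" by blast
    then have "(T ^^ (max m n)) (u + v) = 0"
      using funpow_eq_0_mono[OF assms(1), of _ _ "max m n"] by simp
    then show ?case ..
  next
    case (scale c v)
    then obtain n where "(T ^^ n) v = 0" by blast
    then have "(T ^^ n) (cscale c v) = 0" by simp
    then show ?case ..
  qed (simp_all add: assms(2))
qed

lemma locally_nilpotent_cscale:
  assumes "locally_nilpotent T" "clinear_map T"
  shows "locally_nilpotent (\<lambda>v. cscale c (T v))"
proof -
  have "((\<lambda>v. cscale c (T v)) ^^ n) v = cscale (c ^ n) ((T ^^ n) v)" for n v
    by (induction n) (simp_all add: clinear_map_simps[OF assms(2)])
  then show ?thesis
    using assms(1) by (fastforce simp: locally_nilpotent_def)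
qed

text \<open>By surjectivity every vector has the form \<open>T v\<close>, and \<open>Y ^^ n\<close>
  at \<open>T v\<close> is the image of \<open>X ^^ n\<close> at \<open>v\<close>.\<close>

lemma locally_nilpotent_transport:
  fixes T :: "'i vec \<Rightarrow> 'j vec"
  assumes "locally_nilpotent X" "\<And>v. T (X v) = Y (T v)" "surj T" "clinear_map T"
  shows "locally_nilpotent Y"
  unfolding locally_nilpotent_def
proof
  fix w
  obtain v where w: "w = T v" using assms(3) by blast
  have *: "T ((X ^^ n) v) = (Y ^^ n) (T v)" for n
    by (induction n) (simp_all add: assms(2))
  obtain n where "(X ^^ n) v = 0" using assms(1) by (auto simp: locally_nilpotent_def)
  then have "(Y ^^ n) w = 0"
    using *[of n] by (simp add: w clinear_map_simps[OF assms(4)])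
  then show "\<exists>n. (Y ^^ n) w = 0" ..
qed

text \<open>If \<open>A^m v = 0\<close> and \<open>B^n v = 0\<close>, then
  \<open>(A + B)^(m + n) v = 0\<close>, by induction on \<open>m + n\<close>: \<open>A v\<close> is
  killed by \<open>A^(m - 1)\<close> and \<open>B^n\<close>, and \<open>B v\<close> by
  \<open>A^m\<close> and \<open>B^(n - 1)\<close>. That \<open>A^m\<close> kills \<open>B v\<close>
  follows from \<open>p^m A^m B = B A^m\<close> and \<open>p \<noteq> 0\<close>.\<close>

lemma locally_nilpotent_add:
  assumes lin: "clinear_map A" "clinear_map B"
    and comm: "\<And>v. B (A v) = cscale p (A (B v))" and "p \<noteq> 0"
    and nil: "locally_nilpotent A" "locally_nilpotent B"
  shows "locally_nilpotent (\<lambda>v. A v + B v)"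
  unfolding locally_nilpotent_def
proof
  note [simp] = clinear_map_simps[OF lin(1)] clinear_map_simps[OF lin(2)]
    clinear_map_simps[OF clinear_map_funpow[OF lin(1)]]
    clinear_map_simps[OF clinear_map_funpow[OF lin(2)]]
  have BA: "(B ^^ n) (A v) = cscale (p ^ n) (A ((B ^^ n) v))" for n v
    by (induction n) (simp_all add: comm mult.commute)
  have AB: "cscale (p ^ n) ((A ^^ n) (B v)) = B ((A ^^ n) v)" for n v
  proof (induction n)
    case (Suc n)
    have "cscale (p ^ Suc n) ((A ^^ Suc n) (B v)) = cscale p (A (cscale (p ^ n) ((A ^^ n) (B v))))"
      by simp
    then show ?case by (simp add: Suc comm del: vec.scale_scale)
  qed simp
  have vanish: "((\<lambda>v. A v + B v) ^^ (m + n)) v = 0" if "(A ^^ m) v = 0" "(B ^^ n) v = 0" for m n v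
    using that
  proof (induction "m + n" arbitrary: m n v)
    case 0
    then show ?case by simp
  next
    case (Suc k)
    have lin': "clinear_map (\<lambda>v. A v + B v)" using lin by simp
    have "((\<lambda>v. A v + B v) ^^ k) (A v) = 0"
    proof (cases m)
      \<comment> \<open>For \<open>m = 0\<close> the assumption on \<open>A\<close> says
        \<open>v = 0\<close>.\<close>
      case 0
      then show ?thesis using Suc.prems clinear_map_simps(3)[OF clinear_map_funpow[OF lin']] by simp
    next
      case (Suc m')
      with Suc.hyps(2) have "k = m' + n" by simp
      moreover have "(A ^^ m') (A v) = 0" using Suc.prems Suc by (simp add: funpow_swap1)
      moreover have "(B ^^ n) (A v) = 0" using Suc.prems by (simp add: BA)
      ultimately show ?thesis using Suc.hyps(1)[of m' n "A v"] by simp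
    qed
    moreover have "((\<lambda>v. A v + B v) ^^ k) (B v) = 0"
    proof (cases n)
      case 0
      then show ?thesis using Suc.prems clinear_map_simps(3)[OF clinear_map_funpow[OF lin']] by simp
    next
      case (Suc n')
      with Suc.hyps(2) have "k = m + n'" by simp
      moreover have "(B ^^ n') (B v) = 0" using Suc.prems Suc by (simp add: funpow_swap1)
      moreover have "(A ^^ m) (B v) = 0" using Suc.prems AB[of m v] \<open>p \<noteq> 0\<close> by simp
      ultimately show ?thesis using Suc.hyps(1)[of m n' "B v"] by simp
    qed
    ultimately show ?case
      unfolding Suc.hyps(2)[symmetric]
      by (simp add: funpow_Suc_right clinear_map_simps[OF clinear_map_funpow[OF lin']] del:
          funpow.simps)
  qed
  fix v
  obtain m n where "(A ^^ m) v = 0" "(B ^^ n) v = 0"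
    using nil unfolding locally_nilpotent_def by blast
  then show "\<exists>n. ((\<lambda>v. A v + B v) ^^ n) v = 0"
    using vanish by blast
qed

text \<open>The coefficients are kept arbitrary: transport and linearity hold for all of them, and
  bijectivity is derived from the constant term alone.\<close>

definition ser :: "(nat \<Rightarrow> complex) \<Rightarrow> ('i vec \<Rightarrow> 'i vec) \<Rightarrow> 'i vec \<Rightarrow> 'i vec" where
  "ser a X v = Sum_any (\<lambda>n. cscale (a n) ((X ^^ n) v))"

lemma ser_eq_sum:
  assumes "\<And>n. n \<ge> N \<Longrightarrow> (X ^^ n) v = 0"
  shows "ser a X v = (\<Sum>n<N. cscale (a n) ((X ^^ n) v))"
  unfolding ser_def by (rule Sum_any_eq_sum_lessThan) (simp add: assms)

lemma qexp_eq_ser: "qexp p X = ser (\<lambda>n. 1 / qnum_fact p n) X"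
  by (simp add: fun_eq_iff qexp_def ser_def)

text \<open>The powers of \<open>Y\<close> at \<open>T v\<close> are the images of the powers of
  \<open>X\<close> at \<open>v\<close>, so both series stop at the same place and \<open>T\<close>
  passes through the finite sum.\<close>

lemma ser_transport:
  fixes T :: "'i vec \<Rightarrow> 'j vec"
  assumes "locally_nilpotent X" "clinear_map X" "clinear_map T" "\<And>v. T (X v) = Y (T v)"
  shows "T (ser a X v) = ser a Y (T v)"
proof -
  have *: "T ((X ^^ n) v) = (Y ^^ n) (T v)" for n v
    by (induction n) (simp_all add: assms)
  obtain N where N: "\<And>n. n \<ge> N \<Longrightarrow> (X ^^ n) v = 0"
    using locally_nilpotentD1[OF assms(1,2)] by blast
  have "(Y ^^ n) (T v) = 0" if "n \<ge> N" for n
    using N[OF that] *[of n v] by (simp add: clinear_map_simps[OF assms(3)])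
  then have "ser a Y (T v) = (\<Sum>n<N. cscale (a n) ((Y ^^ n) (T v)))"
    by (rule ser_eq_sum)
  also have "\<dots> = T (ser a X v)"
    by (simp add: ser_eq_sum[OF N] clinear_map_sum[OF assms(3)] clinear_map_simps[OF assms(3)] *)
  finally show ?thesis ..
qed

lemma clinear_ser:
  assumes "locally_nilpotent X" "clinear_map X"
  shows "clinear_map (ser a X)"
  unfolding clinear_map_iff
proof (intro conjI allI)
  note [simp] = clinear_map_simps[OF clinear_map_funpow[OF assms(2)]]
  fix u v :: "'a vec" and c
  obtain N where N: "\<And>n w. n \<ge> N \<Longrightarrow> w \<in> {u, v, u + v, cscale c v} \<Longrightarrow> (X ^^ n) w = 0"
    using locally_nilpotentD[OF assms, of "{u, v, u + v, cscale c v}"] by auto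
  show "ser a X (u + v) = ser a X u + ser a X v"
    using N by (subst (1 2 3) ser_eq_sum[where N = N])
      (auto simp: vec.scale_right_distrib sum.distrib)
  show "ser a X (cscale c v) = cscale c (ser a X v)"
    using N by (subst (1 2) ser_eq_sum[where N = N])
      (auto simp: vec.scale_sum_right mult.commute)
qed

text \<open>The series is unipotent. If \<open>X^(N + 1) v = 0\<close>, then \<open>X^N\<close> sees
  only the constant term of the series, which is the fact \<open>tail\<close>. Hence a vector of the
  kernel is killed by lower and lower powers of \<open>X\<close>, and a preimage of \<open>v\<close>
  is found by applying the induction hypothesis to the defect \<open>v - ser a X v\<close>.\<close>

lemma bij_ser:
  assumes "locally_nilpotent X" "clinear_map X" "a 0 = 1"
  shows "bij (ser a X)"
proof (rule bijI)
  note [simp] = clinear_map_simps[OF clinear_map_funpow[OF assms(2)]]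
    clinear_map_simps[OF clinear_ser[OF assms(1,2)]] clinear_map_simps[OF assms(2)]
  have tail: "(X ^^ N) (ser a X v) = (X ^^ N) v" if "(X ^^ Suc N) v = 0" for N v
  proof -
    have 0: "(X ^^ n) v = 0" if "n \<ge> Suc N" for n
      using funpow_eq_0_mono[OF assms(2) \<open>(X ^^ Suc N) v = 0\<close> that] .
    have z: "(X ^^ N) ((X ^^ Suc n) v) = 0" for n
      using 0[of "N + Suc n"] by (simp only: funpow_add o_apply)
    have "(X ^^ N) (ser a X v) = (\<Sum>n<Suc N. cscale (a n) ((X ^^ N) ((X ^^ n) v)))"
      by (subst ser_eq_sum[OF 0]) (simp_all add: clinear_map_sum[OF clinear_map_funpow[OF
          assms(2)]] del: funpow.simps sum.lessThan_Suc)
    also have "\<dots> = (X ^^ N) v"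
      unfolding sum.lessThan_Suc_shift z by (simp add: assms(3))
    finally show ?thesis .
  qed
  show "inj (ser a X)"
  proof (rule injI)
    fix u v assume "ser a X u = ser a X v"
    then have *: "ser a X (u - v) = 0" by simp
    have "(X ^^ n) (u - v) = 0 \<Longrightarrow> u - v = 0" for n
    proof (induction n)
      case (Suc n)
      then show ?case using tail[of n "u - v"] * by (simp del: funpow.simps)
    qed simp
    then show "u = v" using assms(1) unfolding locally_nilpotent_def by (metis eq_iff_diff_eq_0)
  qed
  have "v \<in> range (ser a X)" if "(X ^^ n) v = 0" for n v
    using that
  proof (induction n arbitrary: v)
    case 0
    have "ser a X 0 = 0" by simp
    then show ?case using 0 by (metis funpow_0 rangeI)
  next
    case (Suc n)
    have "(X ^^ n) (v - ser a X v) = 0"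
      using tail[OF Suc.prems] by simp
    then obtain u where "v - ser a X v = ser a X u" using Suc.IH by blast
    then have "v = ser a X (u + v)" by (simp add: algebra_simps)
    then show ?case by blast
  qed
  then show "surj (ser a X)"
    using assms(1) unfolding locally_nilpotent_def by blast
qed

section \<open>q-exponentials\<close>

lemma qnum_0 [simp]: "qnum p 0 = 0"
  by (simp add: qnum_def)

lemma qnum_fact_0 [simp]: "qnum_fact p 0 = 1"
  by (simp add: qnum_fact_def)

lemma qnum_fact_Suc: "qnum_fact p (Suc n) = qnum_fact p n * qnum p (Suc n)"
  by (simp add: qnum_fact_def)

text \<open>The recursion behind the q-binomial theorem.\<close>

lemma qnum_add: "p \<noteq> 1 \<Longrightarrow> qnum p (m + n) = qnum p m + p ^ m * qnum p n"
  by (simp add: qnum_def field_simps power_add)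

text \<open>Excluding roots of unity keeps all p-factorials nonzero.\<close>

locale root_free =
  fixes p :: complex
  assumes power_neq_1: "n \<ge> 1 \<Longrightarrow> p ^ n \<noteq> 1"
begin

lemma p_neq_1 [simp]: "p \<noteq> 1"
  using power_neq_1[of 1] by simp

lemma qnum_neq_0 [simp]: "qnum p (Suc n) \<noteq> 0"
  using power_neq_1[of "Suc n"] p_neq_1 by (simp add: qnum_def)

text \<open>The p-divided power, which is the general term of the p-exponential.\<close>

definition qpower :: "('i vec \<Rightarrow> 'i vec) \<Rightarrow> nat \<Rightarrow> 'i vec \<Rightarrow> 'i vec" where
  "qpower X n v = cscale (1 / qnum_fact p n) ((X ^^ n) v)"

lemma qexp_eq_sum:
  assumes "\<And>n. n \<ge> N \<Longrightarrow> (X ^^ n) v = 0"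
  shows "qexp p X v = (\<Sum>n<N. qpower X n v)"
  unfolding qexp_eq_ser qpower_def by (rule ser_eq_sum) (rule assms)

lemma qpower_Suc:
  assumes "clinear_map X"
  shows "X (qpower X n v) = cscale (qnum p (Suc n)) (qpower X (Suc n) v)"
  by (simp add: qpower_def clinear_map_simps[OF assms] qnum_fact_Suc)

text \<open>The q-binomial theorem; divided powers make the binomial coefficients disappear. In the
  induction step \<open>A\<close> raises the first exponent to \<open>k\<close> with factor
  \<open>qnum p k\<close>, while \<open>B\<close> passes \<open>k\<close> factors \<open>A\<close>
  with \<open>p ^ k\<close> and raises the second exponent with factor
  \<open>qnum p (Suc n - k)\<close>. The two weights add up to \<open>qnum p (Suc n)\<close>, which
  cancels.\<close>

lemma qpower_add:
  assumes lin: "clinear_map A" "clinear_map B"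
    and comm: "\<And>v. B (A v) = cscale p (A (B v))"
  shows "qpower (\<lambda>v. A v + B v) n v = (\<Sum>k\<le>n. qpower A k (qpower B (n - k) v))"
proof (induction n)
  case (Suc n)
  note [simp] = clinear_map_simps[OF lin(1)] clinear_map_simps[OF lin(2)]
    clinear_map_simps[OF clinear_map_funpow[OF lin(1)]]
  let ?S = "\<lambda>v. A v + B v"
  let ?t = "\<lambda>k. qpower A k (qpower B (Suc n - k) v)"
  have BA: "B (qpower A k w) = cscale (p ^ k) (qpower A k (B w))" for k w
  proof -
    have "B ((A ^^ k) w) = cscale (p ^ k) ((A ^^ k) (B w))"
      by (induction k) (simp_all add: comm)
    then show ?thesis by (simp add: qpower_def mult.commute)
  qed
  have qpower_scale: "qpower A k (cscale c w) = cscale c (qpower A k w)" for k c w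
    by (simp add: qpower_def mult.commute)
  have "cscale (qnum p (Suc n)) (qpower ?S (Suc n) v) = ?S (qpower ?S n v)"
    using lin by (simp only: qpower_Suc[symmetric] clinear_map_add)
  also have "\<dots> = (\<Sum>k\<le>n. A (qpower A k (qpower B (n - k) v)))
      + (\<Sum>k\<le>n. B (qpower A k (qpower B (n - k) v)))"
    by (simp add: Suc clinear_map_sum[OF lin(1)] clinear_map_sum[OF lin(2)])
  \<comment> \<open>The index is shifted by one. The term added at \<open>k = 0\<close> vanishes
    because \<open>qnum p 0 = 0\<close>, as does the term added at \<open>k = Suc n\<close> in the
    sum for \<open>B\<close>.\<close>
  also have "(\<Sum>k\<le>n. A (qpower A k (qpower B (n - k) v))) = (\<Sum>k\<le>Suc n. cscale (qnum p k) (?t k))"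
    by (subst sum.atMost_Suc_shift) (simp add: qpower_Suc[OF lin(1)])
  also have "(\<Sum>k\<le>n. B (qpower A k (qpower B (n - k) v)))
      = (\<Sum>k\<le>Suc n. cscale (p ^ k * qnum p (Suc n - k)) (?t k))"
    by (simp add: BA qpower_Suc[OF lin(2)] qpower_scale Suc_diff_le)
  also have "(\<Sum>k\<le>Suc n. cscale (qnum p k) (?t k)) + \<dots>
      = (\<Sum>k\<le>Suc n. cscale (qnum p k + p ^ k * qnum p (Suc n - k)) (?t k))"
    by (simp add: vec.scale_left_distrib sum.distrib del: sum.atMost_Suc)
  also have "\<dots> = (\<Sum>k\<le>Suc n. cscale (qnum p (Suc n)) (?t k))"
    by (intro sum.cong refl) (simp flip: qnum_add)
  also have "\<dots> = cscale (qnum p (Suc n)) (\<Sum>k\<le>Suc n. ?t k)"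
    by (simp only: vec.scale_sum_right)
  finally show ?case by (simp only: vec.scale_cancel_left) simp
qed (simp add: qpower_def)

text \<open>By the binomial theorem the left side is a sum over a triangle of exponent pairs; the
  right side is a sum over a rectangle inside it. The terms outside the rectangle vanish.\<close>

lemma qexp_add:
  assumes lin: "clinear_map A" "clinear_map B"
    and comm: "\<And>v. B (A v) = cscale p (A (B v))" and "p \<noteq> 0"
    and nil: "locally_nilpotent A" "locally_nilpotent B"
  shows "qexp p (\<lambda>v. A v + B v) v = qexp p A (qexp p B v)"
proof -
  note [simp] = clinear_map_simps[OF lin(1)] clinear_map_simps[OF lin(2)]
    clinear_map_simps[OF clinear_map_funpow[OF lin(1)]]
  have linS: "clinear_map (\<lambda>v. A v + B v)" using lin by simp
  have nilS: "locally_nilpotent (\<lambda>v. A v + B v)"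
    by (rule locally_nilpotent_add[OF lin comm \<open>p \<noteq> 0\<close> nil])
  have lin_qp: "clinear_map (qpower A k)" for k
    using clinear_map_cscale[OF clinear_map_funpow[OF lin(1)]] by (simp add: qpower_def[abs_def])
  obtain N where N: "\<And>n. n \<ge> N \<Longrightarrow> (B ^^ n) v = 0"
    using locally_nilpotentD1[OF nil(2) lin(2)] by blast
  \<comment> \<open>The bound for \<open>A\<close> has to serve every divided power of
    \<open>B\<close> at \<open>v\<close> as well as their sum.\<close>
  obtain M where M: "\<And>n w. n \<ge> M \<Longrightarrow> w \<in> insert (qexp p B v) ((\<lambda>k. qpower B k v) ` {..<N}) \<Longrightarrow> (A ^^
      n) w = 0"
    using locally_nilpotentD[OF nil(1) lin(1), of "insert (qexp p B v) ((\<lambda>k. qpower B k v) `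
        {..<N})"]
    by (metis finite_imageI finite_insert finite_lessThan)
  have zero: "qpower A k (qpower B m v) = 0" if "k \<ge> M \<or> m \<ge> N" for k m
  proof (cases "m \<ge> N")
    case True
    then show ?thesis by (simp add: qpower_def N)
  next
    case False
    then show ?thesis using that M[of k "qpower B m v"] by (simp add: qpower_def[of A])
  qed
  obtain K where K: "\<And>n. n \<ge> K \<Longrightarrow> ((\<lambda>v. A v + B v) ^^ n) v = 0"
    using locally_nilpotentD1[OF nilS linS] by blast
  \<comment> \<open>\<open>K\<close> truncates the series of the sum, and \<open>M + N\<close> makes
    the triangle contain the rectangle.\<close>
  define L where "L = max K (M + N)"
  have "qexp p (\<lambda>v. A v + B v) v = (\<Sum>n<L. \<Sum>k\<le>n. qpower A k (qpower B (n - k) v))"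
    by (subst qexp_eq_sum[of L]) (simp_all add: K L_def qpower_add[OF lin comm])
  also have "\<dots> = (\<Sum>(k, m)\<in>{(k, m). k + m < L}. qpower A k (qpower B m v))"
    by (simp only: sum.triangle_reindex)
  also have "\<dots> = (\<Sum>(k, m)\<in>{..<M} \<times> {..<N}. qpower A k (qpower B m v))"
  proof (rule sum.mono_neutral_right)
    show "finite {(k, m). k + m < L}"
      by (rule finite_subset[of _ "{..<L} \<times> {..<L}"]) auto
    show "\<forall>x\<in>{(k, m). k + m < L} - {..<M} \<times> {..<N}. (case x of (k, m) \<Rightarrow> qpower A k (qpower B m v))
        = 0"
      by (auto intro!: zero simp: not_less)
  qed (auto simp: L_def)
  also have "\<dots> = (\<Sum>k<M. qpower A k (\<Sum>m<N. qpower B m v))"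
    by (simp add: sum.cartesian_product clinear_map_sum[OF lin_qp])
  also have "(\<Sum>m<N. qpower B m v) = qexp p B v"
    by (rule qexp_eq_sum[symmetric]) (rule N)
  also have "(\<Sum>k<M. qpower A k \<dots>) = qexp p A (qexp p B v)"
    by (rule qexp_eq_sum[symmetric]) (simp add: M)
  finally show ?thesis .
qed

text \<open>By induction \<open>Y^(n + 1) f = f Y^(n + 1) + [n + 1] (e' Y^n - Y^n e)\<close>, where
  \<open>[n]\<close> is \<open>qnum p n\<close>. Division by the p-factorial of \<open>n + 1\<close>
  turns the last two terms into divided powers of order \<open>n\<close>, and summation over
  \<open>n\<close> gives the claim.\<close>

lemma qexp_intertwine:
  assumes lin: "clinear_map Y" "clinear_map f" "clinear_map e'" and nil: "locally_nilpotent Y"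
    and f: "\<And>v. Y (f v) = f (Y v) + e' v - e v"
    and e: "\<And>v. e (Y v) = cscale p (Y (e v))"
    and e': "\<And>v. Y (e' v) = cscale p (e' (Y v))"
  shows "qexp p Y (f v + e v) = f (qexp p Y v) + e' (qexp p Y v)"
proof -
  note [simp] = clinear_map_simps[OF lin(1)] clinear_map_simps[OF lin(2)] clinear_map_simps[OF
      lin(3)]
    clinear_map_simps[OF clinear_map_funpow[OF lin(1)]]
  have Ye': "(Y ^^ n) (e' v) = cscale (p ^ n) (e' ((Y ^^ n) v))" for n v
    by (induction n) (simp_all add: e' mult.commute)
  \<comment> \<open>The first recursion collects the terms with \<open>e'\<close>, the second those
    with \<open>e\<close>.\<close>
  have qnum_Suc: "qnum p (Suc n) = qnum p n + p ^ n" "qnum p (Suc n) = 1 + p * qnum p n" for n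
    using p_neq_1 by (simp_all add: qnum_def field_simps)
  have power: "(Y ^^ Suc n) (f v) = f ((Y ^^ Suc n) v)
      + cscale (qnum p (Suc n)) (e' ((Y ^^ n) v) - (Y ^^ n) (e v))" for n v
  proof (induction n arbitrary: v)
    case 0
    then show ?case by (simp add: f qnum_def)
  next
    case (Suc n)
    have "(Y ^^ Suc (Suc n)) (f v) = (Y ^^ Suc n) (f (Y v)) + (Y ^^ Suc n) (e' v) - (Y ^^ Suc n)
        (e v)"
      by (simp only: funpow_Suc_right[of "Suc n"] o_apply f clinear_map_simps[OF
          clinear_map_funpow[OF lin(1)]])
    also have "(Y ^^ Suc n) (f (Y v)) = f ((Y ^^ Suc (Suc n)) v)
      + cscale (qnum p (Suc n)) (e' ((Y ^^ Suc n) v) - cscale p ((Y ^^ Suc n) (e v)))"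
      by (simp only: Suc) (simp add: e funpow_swap1)
    also have "(Y ^^ Suc n) (e' v) = cscale (p ^ Suc n) (e' ((Y ^^ Suc n) v))"
      by (rule Ye')
    finally show ?case
      unfolding vec.scale_right_diff_distrib
      by (simp only:, subst (1) qnum_Suc(1)[of "Suc n"], subst qnum_Suc(2)[of "Suc n"])
         (rule vec_eqI, simp add: lookup_vec algebra_simps)
  qed
  have qp: "qpower Y (Suc n) (f v) = f (qpower Y (Suc n) v) + (e' (qpower Y n v) - qpower Y n (e
      v))" for n
    unfolding qpower_def power qnum_fact_Suc
    by (simp add: vec.scale_right_distrib vec.scale_right_diff_distrib del: funpow.simps)
  obtain N where N: "\<And>n w. n \<ge> N \<Longrightarrow> w \<in> {v, f v, e v, f v + e v} \<Longrightarrow> (Y ^^ n) w = 0"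
    using locally_nilpotentD[OF nil lin(1), of "{v, f v, e v, f v + e v}"] by auto
  have "qexp p Y (f v + e v) = qexp p Y (f v) + qexp p Y (e v)"
    unfolding qexp_eq_ser by (rule clinear_map_simps(1)[OF clinear_ser[OF nil lin(1)]])
  \<comment> \<open>One term more than for \<open>e\<close>: the term of order \<open>n + 1\<close>
    at \<open>f v\<close> involves that of order \<open>n\<close> at \<open>e v\<close>.\<close>
  also have "qexp p Y (f v) = (\<Sum>n<Suc N. qpower Y n (f v))"
    using N by (intro qexp_eq_sum) auto
  also have "\<dots> = f (\<Sum>n<Suc N. qpower Y n v) + e' (\<Sum>n<N. qpower Y n v) - (\<Sum>n<N. qpower Y n (e v))"
    by (simp add: clinear_map_sum[OF lin(2)] clinear_map_sum[OF lin(3)] sum.lessThan_Suc_shift qp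
        sum.distrib sum_subtractf del: sum.lessThan_Suc) (simp add: qpower_def)
  also have "(\<Sum>n<N. qpower Y n (e v)) = qexp p Y (e v)"
    using N by (intro qexp_eq_sum[symmetric]) auto
  also have "(\<Sum>n<N. qpower Y n v) = qexp p Y v"
    using N by (intro qexp_eq_sum[symmetric]) auto
  also have "(\<Sum>n<Suc N. qpower Y n v) = qexp p Y v"
    using N by (intro qexp_eq_sum[symmetric]) auto
  finally show ?thesis by simp
qed

end

section \<open>Weight modules\<close>

lemma tens_ext_all:
  assumes "clinear_map S" "clinear_map T" "\<And>v w. S (tens v w) = T (tens v w)"
  shows "\<forall>v. S v = T v"
  using tens_ext[OF assms] by simp

lemma tmap_funpow_tens:
  fixes A :: "'i vec \<Rightarrow> 'i vec" and B :: "'j vec \<Rightarrow> 'j vec"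
  assumes "clinear_map A" "clinear_map B"
  shows "(tmap A B ^^ n) (tens v w) = tens ((A ^^ n) v) ((B ^^ n) w)"
  by (induction n) (simp_all add: assms)

lemma locally_nilpotent_tmap:
  assumes "clinear_map A" "clinear_map B" "locally_nilpotent A \<or> locally_nilpotent B"
  shows "locally_nilpotent (tmap A B)"
proof (rule locally_nilpotent_basis)
  fix x :: "'a \<times> 'b"
  obtain i j where x: "x = (i, j)" by force
  from assms(3) have "\<exists>n. (A ^^ n) (basis_vec i) = 0 \<or> (B ^^ n) (basis_vec j) = 0"
    by (auto simp: locally_nilpotent_def)
  then obtain n where "(A ^^ n) (basis_vec i) = 0 \<or> (B ^^ n) (basis_vec j) = 0" ..
  then have "(tmap A B ^^ n) (basis_vec x) = 0"
    by (auto simp: x tmap_funpow_tens[OF assms(1,2)] simp flip: tens_basis_vec)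
  then show "\<exists>n. (tmap A B ^^ n) (basis_vec x) = 0" ..
qed simp

section \<open>Powers of \<open>q\<^sub>*\<close> and of \<open>q\<^sub>*^H\<close>, and the
  parameters\<close>

lemma qpow_add: "qpow b (x + y) = qpow b x * qpow b y"
  by (simp add: qpow_def distrib_left exp_add)

lemma qpow_0 [simp]: "qpow b 0 = 1"
  by (simp add: qpow_def)

lemma qpow_1: "qpow b 1 = qpar b"
  by (simp add: qpow_def qpar_def)

lemma qpar_neq_0 [simp]: "qpar b \<noteq> 0"
  by (simp add: qpar_def)

lemma qpow_minus: "qpow b (- x) = inverse (qpow b x)"
  by (simp add: qpow_def exp_minus)

lemma qpow_neq_0 [simp]: "qpow b x \<noteq> 0"
  by (simp add: qpow_def)

lemma clinear_qH [simp]: "clinear_map (qH bs h s)"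
  by (simp add: qH_def)

lemmas qH_simps [simp] = clinear_map_simps[OF clinear_qH]

lemma qH_eq_diag: "qH bs h s = diag (\<lambda>i. qpow bs (s * h i))"
  by (simp add: qH_def diag_def)

lemma qH_qH: "qH bs h s (qH bs h t v) = qH bs h (s + t) v"
  by (simp add: qH_eq_diag diag_diag distrib_right qpow_add)

lemma qH_0 [simp]: "qH bs h 0 v = v"
  by (simp add: qH_eq_diag diag_one)

lemma sg_qH: "sg p (qH bs h s v) = qH bs h s (sg p v)"
  by (simp add: qH_eq_diag sg_def diag_diag mult.commute)

text \<open>The exponentiated form of \<open>[H, T] = d T\<close>.\<close>

lemma qH_shift:
  assumes "clinear_map T" "shifts_weight h T d"
  shows "qH bs h s (T v) = cscale (qpow bs (s * d)) (T (qH bs h s v))"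
proof -
  have "\<forall>i. \<forall>j\<in>Poly_Mapping.keys (T (basis_vec i)). qpow bs (s * h j) = qpow bs (s * d) * qpow bs
      (s * h i)"
    using assms(2) by (auto simp: shifts_weight_def distrib_left qpow_add mult.commute)
  then have "qH bs h s (T v) = T (diag (\<lambda>i. qpow bs (s * d) * qpow bs (s * h i)) v)"
    unfolding diag_intertwine_iff[OF assms(1)] by (simp add: qH_eq_diag)
  also have "diag (\<lambda>i. qpow bs (s * d) * qpow bs (s * h i)) v = cscale (qpow bs (s * d)) (qH bs h
      s v)"
    by (rule vec_eqI) (simp add: qH_eq_diag lookup_diag lookup_vec)
  finally show ?thesis by (simp add: clinear_map_simps[OF assms(1)])
qed

text \<open>That \<open>q\<close> is not a root of unity makes \<open>q + q^-1\<close> nonzero and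
  keeps \<open>p = - q^-2 = q\<^sub>*^-2\<close> from being a root of unity.\<close>

locale osp_params =
  fixes b bs :: complex
  assumes b_bs: "b^2 = bs^2 + 1/2"
    and q_root_free: "n \<ge> 1 \<Longrightarrow> qpar b ^ n \<noteq> 1"
begin

text \<open>Adding 1/2 to \<open>bs^2\<close> multiplies the exponential by
  \<open>exp (pi i / 2) = i\<close>.\<close>

lemma qpar_bs: "qpar bs = - \<i> * qpar b"
proof -
  have "qpar b = exp (of_real pi * \<i> * bs^2 + \<i> * of_real (pi / 2))"
    by (simp add: qpar_def b_bs algebra_simps)
  also have "\<dots> = \<i> * qpar bs"
    by (simp add: exp_add qpar_def flip: cis_conv_exp del: of_real_divide)
  finally show ?thesis by simp
qed

text \<open>Thus \<open>q\<^sub>*^H\<close> passes \<E> with the factor \<open>- q^2\<close>. The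
  sign missing in the relation of \<K> and \<E> comes from \<xi>\<eta>, which anticommutes with
  \<E>.\<close>

lemma qpow_bs_2 [simp]: "qpow bs 2 = - ((qpar b)^2)"
  using qpow_add[of bs 1 1] by (simp add: qpow_1 qpar_bs power_mult_distrib flip: power2_eq_square)

lemma qpow_bs_minus_2 [simp]: "qpow bs (- 2) = - inverse ((qpar b)^2)"
  by (simp add: qpow_minus)

lemma q2_neq_minus_1: "(qpar b)^2 \<noteq> - 1"
proof
  assume "(qpar b)^2 = - 1"
  then have "((qpar b)^2)^2 = 1" by simp
  then show False using q_root_free[of 4] by (simp flip: power_mult)
qed

lemma q_plus_inverse_neq_0 [simp]: "qpar b + inverse (qpar b) \<noteq> 0"
proof
  assume "qpar b + inverse (qpar b) = 0"
  then have "qpar b * (qpar b + inverse (qpar b)) = 0" by simp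
  then show False using q2_neq_minus_1
    by (simp add: distrib_left power2_eq_square add_eq_0_iff2)
qed

abbreviation p :: complex where
  "p \<equiv> - inverse ((qpar b)^2)"

sublocale root_free p
proof
  fix n :: nat assume "n \<ge> 1"
  show "p ^ n \<noteq> 1"
  proof
    assume "p ^ n = 1"
    \<comment> \<open>Squaring removes the sign of \<open>p\<close>.\<close>
    then have "(p ^ n)^2 = 1" by simp
    also have "(p ^ n)^2 = inverse (qpar b ^ (4 * n))"
      by (simp add: power_inverse mult.commute flip: power_mult)
    finally show False
      using q_root_free[of "4 * n"] \<open>n \<ge> 1\<close> by simp
  qed
qed

end

section \<open>Relations in a single weight module\<close>

locale osp_weight = osp_params b bs for b bs +
  fixes M :: "'i osp_module"
  assumes weight_module: "osp_weight_module b bs M"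
begin

lemma clinear_XE [simp]: "clinear_map (XE M)"
  and clinear_EE [simp]: "clinear_map (EE M)"
  and clinear_FF [simp]: "clinear_map (FF M)"
  and even_XE: "even_map (par M) (par M) (XE M)"
  and odd_EE: "odd_map (par M) (par M) (EE M)"
  and odd_FF: "odd_map (par M) (par M) (FF M)"
  and shift_XE: "shifts_weight (wt M) (XE M) 0"
  and shift_EE: "shifts_weight (wt M) (EE M) 2"
  and shift_FF: "shifts_weight (wt M) (FF M) (- 2)"
  and XE_XE [simp]: "XE M (XE M v) = - v"
  and XE_EE [simp]: "XE M (EE M v) = - EE M (XE M v)"
  and XE_FF [simp]: "XE M (FF M v) = - FF M (XE M v)"
  and EE_FF: "EE M (FF M v) + FF M (EE M v) =
        cscale (1 / (qpar b + inverse (qpar b))) (KK bs M v - KK_inv bs M v)"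
  and KK_EE [simp]: "KK bs M (EE M v) = cscale ((qpar b)^2) (EE M (KK bs M v))"
  and KK_FF [simp]: "KK bs M (FF M v) = cscale (inverse ((qpar b)^2)) (FF M (KK bs M v))"
  and nilpotent_EE: "locally_nilpotent (EE M)"
  using weight_module by (simp_all add: osp_weight_module_def)

lemmas XE_simps [simp] = clinear_map_simps[OF clinear_XE]
lemmas EE_simps [simp] = clinear_map_simps[OF clinear_EE]
lemmas FF_simps [simp] = clinear_map_simps[OF clinear_FF]

lemma clinear_KK [simp]: "clinear_map (KK bs M)" "clinear_map (KK_inv bs M)"
  by (simp_all add: clinear_map_iff KK_def KK_inv_def vec.scale_right_distrib
      vec.scale_right_diff_distrib mult.commute)

lemmas KK_simps [simp] = clinear_map_simps[OF clinear_KK(1)] clinear_map_simps[OF clinear_KK(2)]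

lemma qH_XE [simp]: "qH bs (wt M) s (XE M v) = XE M (qH bs (wt M) s v)"
  using qH_shift[OF clinear_XE shift_XE] by simp

lemma KK_KK_inv [simp]: "KK bs M (KK_inv bs M v) = v" "KK_inv bs M (KK bs M v) = v"
  by (simp_all add: KK_def KK_inv_def qH_qH)

lemma KK_inv_EE [simp]: "KK_inv bs M (EE M v) = cscale (inverse ((qpar b)^2)) (EE M (KK_inv bs M
    v))"
  using qH_shift[OF clinear_EE shift_EE, of bs "- 1" v] by (simp add: KK_inv_def mult.commute)

lemma KK_inv_FF [simp]: "KK_inv bs M (FF M v) = cscale ((qpar b)^2) (FF M (KK_inv bs M v))"
  using qH_shift[OF clinear_FF shift_FF, of bs "- 1" v] by (simp add: KK_inv_def mult.commute)

lemma XE_KK [simp]: "XE M (KK bs M v) = KK bs M (XE M v)" "XE M (KK_inv bs M v) = KK_inv bs M (XE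
    M v)"
  by (simp_all add: KK_def KK_inv_def)

lemma sg_XE [simp]: "sg (par M) (XE M v) = XE M (sg (par M) v)"
  using even_XE by (simp add: even_map_iff)

lemma sg_EE [simp]: "sg (par M) (EE M v) = - EE M (sg (par M) v)"
  using odd_EE by (simp add: odd_map_iff)

lemma sg_FF [simp]: "sg (par M) (FF M v) = - FF M (sg (par M) v)"
  using odd_FF by (simp add: odd_map_iff)

lemma sg_KK [simp]: "sg (par M) (KK bs M v) = KK bs M (sg (par M) v)"
  "sg (par M) (KK_inv bs M v) = KK_inv bs M (sg (par M) v)"
  by (simp_all add: KK_def KK_inv_def sg_qH)

lemma even_KK: "even_map (par M) (par M) (KK bs M)" "even_map (par M) (par M) (KK_inv bs M)"
  by (simp_all add: even_map_iff)

text \<open>Oriented to move \<open>FF\<close> to the left. Together with the other rules this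
  orders products as \<open>FF\<close>, \<open>EE\<close>, \<open>KK\<close>, \<open>XE\<close>,
  parity, so that relations on tensor products can be settled by simplification.\<close>

lemma EE_FF_reorder [simp]: "EE M (FF M v) = cscale (1 / (qpar b + inverse (qpar b)))
     (KK bs M v - KK_inv bs M v) - FF M (EE M v)"
  using EE_FF[of v] by (simp add: algebra_simps)

end

lemma even_map_id: "even_map p p id"
  by (simp add: even_map_iff)

section \<open>The tensor product of two weight modules\<close>

locale osp_weight2 = M: osp_weight b bs M + N: osp_weight b bs N
  for b bs and M :: "'m osp_module" and N :: "'n osp_module"
begin

lemma tensor_par: "sg (par (tensor_module bs M N)) = tmap (sg (par M)) (sg (par N))"
  by (simp add: tensor_module_def sg_tens del: not_iff)

lemma tensor_XE: "XE (tensor_module bs M N) = (\<lambda>v. cscale \<i> (tmap (XE M) (XE N) v))"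
  by (simp add: tensor_module_def super_tensor_even[OF N.even_XE])

text \<open>As \<E> is odd, \<open>1 \<otimes> \<E>\<close> acts as
  \<open>\<sigma> \<otimes> \<E>\<close>; as \<K> is even, the other summand carries no
  sign.\<close>

lemma coprod_EE: "coprod bs M N GenE = (\<lambda>v. tmap (EE M) (KK bs N) v + tmap (sg (par M)) (EE N) v)"
  by (simp add: tensor_module_def super_tensor_even[OF N.even_KK(1)] super_tensor_odd[OF N.odd_EE])

lemma coprod_FF: "coprod bs M N GenF =
    (\<lambda>v. tmap (FF M) id v + tmap (KK_inv bs M \<circ> sg (par M)) (FF N) v)"
  by (simp add: tensor_module_def super_tensor_even[OF even_map_id] super_tensor_odd[OF N.odd_FF])

lemma tensor_EE: "EE (tensor_module bs M N) =
    (\<lambda>v. tmap (EE M) (KK bs N) v + tmap (sg (par M)) (EE N) v)"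
  using coprod_EE by (simp add: tensor_module_def)

lemma tensor_FF: "FF (tensor_module bs M N) =
    (\<lambda>v. tmap (FF M) id v + tmap (KK_inv bs M \<circ> sg (par M)) (FF N) v)"
  using coprod_FF by (simp add: tensor_module_def)

lemma tensor_diag_wt: "diag (wt (tensor_module bs M N)) v
    = tmap (diag (wt M)) id v + tmap id (diag (wt N)) v"
  by (simp add: tensor_module_def diag_tens_add)

lemma tensor_qH: "qH bs (wt (tensor_module bs M N)) s = tmap (qH bs (wt M) s) (qH bs (wt N) s)"
  unfolding qH_eq_diag diag_tens_sep[symmetric]
  by (intro arg_cong[of _ _ diag]) (auto simp: tensor_module_def distrib_left qpow_add)

text \<open>The scalar in the action of \<xi>\<eta> on a product is what makes
  \<open>\<i> \<xi>\<eta>\<close>, and with it \<K>, group-like.\<close>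

lemma tensor_KK: "KK bs (tensor_module bs M N) = tmap (KK bs M) (KK bs N)"
    "KK_inv bs (tensor_module bs M N) = tmap (KK_inv bs M) (KK_inv bs N)"
  by (rule tens_ext;
      simp add: clinear_map_iff KK_def[abs_def] KK_inv_def[abs_def] tensor_XE tensor_qH
          vec.scale_right_distrib vec.scale_right_diff_distrib)+

lemma osp_weight_module_tensor: "osp_weight_module b bs (tensor_module bs M N)"
proof -
  let ?T = "tensor_module bs M N"
  note tensor = tensor_XE tensor_EE tensor_FF tensor_KK tensor_par tensor_diag_wt
  have lin: "clinear_map (XE ?T)" "clinear_map (EE ?T)" "clinear_map (FF ?T)"
    by (simp_all add: tensor)
  note [simp] = clinear_map_simps[OF lin(1)] clinear_map_simps[OF lin(2)] clinear_map_simps[OF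
      lin(3)]
  have wtM: "\<And>v. diag (wt M) (XE M v) = XE M (diag (wt M) v)"
    "\<And>v. diag (wt M) (EE M v) = EE M (diag (wt M) v) + cscale 2 (EE M v)"
    "\<And>v. diag (wt M) (FF M v) = FF M (diag (wt M) v) + cscale (- 2) (FF M v)"
    using M.shift_XE M.shift_EE M.shift_FF by (simp_all add: shifts_weight_iff)
  have wtN: "\<And>v. diag (wt N) (XE N v) = XE N (diag (wt N) v)"
    "\<And>v. diag (wt N) (EE N v) = EE N (diag (wt N) v) + cscale 2 (EE N v)"
    "\<And>v. diag (wt N) (FF N v) = FF N (diag (wt N) v) + cscale (- 2) (FF N v)"
    using N.shift_XE N.shift_EE N.shift_FF by (simp_all add: shifts_weight_iff)
  have wtK: "diag h (qH bs h s v) = qH bs h s (diag h v)" "diag h (sg f v) = sg f (diag h v)"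
    for h s v and f :: "'x \<Rightarrow> bool"
    by (simp_all add: qH_eq_diag sg_def diag_diag mult.commute)
  have wtKM: "diag (wt M) (KK_inv bs M v) = KK_inv bs M (diag (wt M) v)" for v
    by (simp add: KK_inv_def wtM wtK)
  have wtKN: "diag (wt N) (KK bs N v) = KK bs N (diag (wt N) v)" for v
    by (simp add: KK_def wtN wtK)
  have even: "even_map (par ?T) (par ?T) (XE ?T)"
    unfolding even_map_iff[OF lin(1)] by (rule tens_ext_all) (simp_all add: clinear_map_iff tensor
        vec.scale_right_distrib vec.scale_right_diff_distrib)
  have odd: "odd_map (par ?T) (par ?T) (EE ?T)" "odd_map (par ?T) (par ?T) (FF ?T)"
    unfolding odd_map_iff[OF lin(2)] odd_map_iff[OF lin(3)]
    by (rule tens_ext_all; simp add: clinear_map_iff tensor vec.scale_right_distrib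
        vec.scale_right_diff_distrib)+
  have shift: "shifts_weight (wt ?T) (XE ?T) 0" "shifts_weight (wt ?T) (EE ?T) 2"
    "shifts_weight (wt ?T) (FF ?T) (- 2)"
    unfolding shifts_weight_iff[OF lin(1)] shifts_weight_iff[OF lin(2)] shifts_weight_iff[OF lin(3)]
    by (rule tens_ext_all; simp add: clinear_map_iff tensor vec.scale_right_distrib
        vec.scale_right_diff_distrib wtM wtN wtK wtKM wtKN algebra_simps;
        rule vec_eqI; simp add: lookup_vec algebra_simps)+
  have XX: "\<forall>v. XE ?T (XE ?T v) = - v"
    by (rule tens_ext_all) (simp_all add: clinear_map_iff tensor vec.scale_right_distrib
        vec.scale_right_diff_distrib)
  have XEF: "\<forall>v. XE ?T (EE ?T v) = - EE ?T (XE ?T v)" "\<forall>v. XE ?T (FF ?T v) = - FF ?T (XE ?T v)"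
    by (rule tens_ext_all; simp add: clinear_map_iff tensor vec.scale_right_distrib
        vec.scale_right_diff_distrib mult.commute)+
  have EF: "\<forall>v. EE ?T (FF ?T v) + FF ?T (EE ?T v) =
      cscale (1 / (qpar b + inverse (qpar b))) (KK bs ?T v - KK_inv bs ?T v)"
    by (rule tens_ext_all; simp add: clinear_map_iff tensor vec.scale_right_distrib
        vec.scale_right_diff_distrib; rule vec_eqI; simp add: lookup_vec algebra_simps)
  have KEF: "\<forall>v. KK bs ?T (EE ?T v) = cscale ((qpar b)^2) (EE ?T (KK bs ?T v))"
     "\<forall>v. KK bs ?T (FF ?T v) = cscale (inverse ((qpar b)^2)) (FF ?T (KK bs ?T v))"
    by (rule tens_ext_all; simp add: clinear_map_iff tensor vec.scale_right_distrib
        vec.scale_right_diff_distrib mult.commute)+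
  \<comment> \<open>The two summands of the coproduct of \<E> commute up to
    \<open>p = - q^-2\<close>: \<sigma> past \<E> gives the sign, and \<E> past \<K> gives
    \<open>q^-2\<close>. Each is locally nilpotent because one of its tensor factors is
    \<E>.\<close>
  have "locally_nilpotent (\<lambda>v. tmap (EE M) (KK bs N) v + tmap (sg (par M)) (EE N) v)"
  proof (rule locally_nilpotent_add)
    fix v
    have "\<forall>v. tmap (sg (par M)) (EE N) (tmap (EE M) (KK bs N) v)
         = cscale M.p (tmap (EE M) (KK bs N) (tmap (sg (par M)) (EE N) v))"
      by (rule tens_ext_all) (simp_all add: clinear_map_iff vec.scale_right_distrib
          vec.scale_right_diff_distrib mult.commute)
    then show "tmap (sg (par M)) (EE N) (tmap (EE M) (KK bs N) v)
         = cscale M.p (tmap (EE M) (KK bs N) (tmap (sg (par M)) (EE N) v))" by blast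
  qed (simp_all add: locally_nilpotent_tmap M.nilpotent_EE N.nilpotent_EE)
  then have "locally_nilpotent (EE ?T)"
    by (simp add: tensor)
  then show ?thesis
    unfolding osp_weight_module_def using lin even odd shift XX XEF EF KEF by blast
qed

end

lemma osp_weight_tensor:
  assumes "osp_weight b bs M" "osp_weight b bs N"
  shows "osp_weight b bs (tensor_module bs M N)"
proof -
  interpret osp_weight2 b bs M N
    using assms by (rule osp_weight2.intro)
  show ?thesis
    by unfold_locales (rule osp_weight_module_tensor)
qed

section \<open>The realization by sl(2) and the Clifford algebra\<close>

lemma clinear_cliff [simp]: "clinear_map cliff_xi" "clinear_map cliff_eta"
  by (simp_all add: cliff_xi_def cliff_eta_def)

lemmas cliff_simps [simp] = clinear_map_simps[OF clinear_cliff(1)] clinear_map_simps[OF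
    clinear_cliff(2)]

lemma cliff_basis_vec:
  "cliff_xi (basis_vec \<epsilon>) = basis_vec (\<not> \<epsilon>)"
  "cliff_eta (basis_vec \<epsilon>) = cscale (if \<epsilon> then \<i> else - \<i>) (basis_vec (\<not> \<epsilon>))"
  by (simp_all add: cliff_xi_def cliff_eta_def)

lemma cliff_relations [simp]:
  "cliff_xi (cliff_xi v) = v" "cliff_eta (cliff_eta v) = v"
  "cliff_eta (cliff_xi v) = - cliff_xi (cliff_eta v)"
  "sg id (cliff_xi v) = - cliff_xi (sg id v)"
  "sg id (cliff_eta v) = - cliff_eta (sg id v)"
proof -
  have "cliff_xi \<circ> cliff_xi = id" "cliff_eta \<circ> cliff_eta = id"
     "cliff_eta \<circ> cliff_xi = (\<lambda>v. cscale (- 1) ((cliff_xi \<circ> cliff_eta) v))"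
     "sg id \<circ> cliff_xi = (\<lambda>v. cscale (- 1) ((cliff_xi \<circ> sg id) v))"
     "sg id \<circ> cliff_eta = (\<lambda>v. cscale (- 1) ((cliff_eta \<circ> sg id) v))"
    by (rule clinear_map_basis_ext;
        auto simp: clinear_map_iff cliff_basis_vec sg_basis_vec)+
  then show "cliff_xi (cliff_xi v) = v" "cliff_eta (cliff_eta v) = v"
    "cliff_eta (cliff_xi v) = - cliff_xi (cliff_eta v)"
    "sg id (cliff_xi v) = - cliff_xi (sg id v)"
    "sg id (cliff_eta v) = - cliff_eta (sg id v)"
    by (simp_all add: fun_eq_iff)
qed

text \<open>Anticommutation of \<xi> and \<eta> turns the commutator into the anticommutator:
  \<open>\<xi>\<eta> E F + \<eta>\<xi> F E = \<xi>\<eta> (E F - F E)\<close>. The factor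
  \<open>\<i>\<close> of \<K> comes from
  \<open>q\<^sub>* - q\<^sub>*^-1 = - \<i> (q + q^-1)\<close>.\<close>

lemma (in osp_params) osp_weight_module_realization:
  assumes "sl2_weight_module bs V"
  shows "osp_weight_module b bs (realization V)"
proof -
  let ?T = "realization V"
  from assms have lin: "clinear_map (sl_E V)" "clinear_map (sl_F V)"
    and sh: "shifts_weight (sl_wt V) (sl_E V) 2" "shifts_weight (sl_wt V) (sl_F V) (- 2)"
    and EF: "\<And>v. sl_E V (sl_F V v) - sl_F V (sl_E V v) =
        cscale (1 / (qpar bs - inverse (qpar bs)))
          (qH bs (sl_wt V) 1 v - qH bs (sl_wt V) (- 1) v)"
    and nil: "locally_nilpotent (sl_E V)"
    by (auto simp: sl2_weight_module_def)
  note [simp] = clinear_map_simps[OF lin(1)] clinear_map_simps[OF lin(2)] lin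
  have X: "XE ?T = tmap id (cliff_xi \<circ> cliff_eta)" and E: "EE ?T = tmap (sl_E V) cliff_xi"
    and F: "FF ?T = tmap (sl_F V) cliff_eta"
    by (simp_all add: realization_def super_tensor_trivial_parity)
  have par: "sg (par ?T) = tmap id (sg id)"
  proof -
    have "par ?T = (\<lambda>(i, j). (\<lambda>_. False) i \<noteq> id j)" by (auto simp: realization_def)
    then show ?thesis by (simp only: sg_tens sg_even)
  qed
  have wt: "diag (wt ?T) = tmap (diag (sl_wt V)) id"
  proof -
    have "wt ?T = (\<lambda>(i, j). sl_wt V i * (\<lambda>_. 1) j)" by (auto simp: realization_def)
    then show ?thesis by (simp only: diag_tens_sep) (simp add: diag_one[abs_def] id_def)
  qed
  have qH: "qH bs (wt ?T) s = tmap (qH bs (sl_wt V) s) id" for s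
  proof -
    have "(\<lambda>i. qpow bs (s * wt ?T i)) = (\<lambda>(i, j). qpow bs (s * sl_wt V i) * (\<lambda>_. 1) j)"
      by (auto simp: realization_def)
    then show ?thesis unfolding qH_eq_diag by (simp only: diag_tens_sep) (simp add:
        diag_one[abs_def] id_def)
  qed
  have K: "KK bs ?T = (\<lambda>v. cscale \<i> (tmap (qH bs (sl_wt V) 1) (cliff_xi \<circ> cliff_eta) v))"
    "KK_inv bs ?T = (\<lambda>v. cscale \<i> (tmap (qH bs (sl_wt V) (- 1)) (cliff_xi \<circ> cliff_eta) v))"
    by (rule tens_ext;
       simp add: clinear_map_iff KK_def[abs_def] KK_inv_def[abs_def] X qH vec.scale_right_distrib
           vec.scale_right_diff_distrib)+
  note tensor = X E F par wt K
  have lin': "clinear_map (XE ?T)" "clinear_map (EE ?T)" "clinear_map (FF ?T)"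
    by (simp_all add: tensor)
  have wtV: "\<And>v. diag (sl_wt V) (sl_E V v) = sl_E V (diag (sl_wt V) v) + cscale 2 (sl_E V v)"
    "\<And>v. diag (sl_wt V) (sl_F V v) = sl_F V (diag (sl_wt V) v) + cscale (- 2) (sl_F V v)"
    using sh by (simp_all add: shifts_weight_iff)
  have qHV: "\<And>v. qH bs (sl_wt V) 1 (sl_E V v) = cscale (- ((qpar b)^2)) (sl_E V (qH bs (sl_wt V) 1
      v))"
    "\<And>v. qH bs (sl_wt V) 1 (sl_F V v) = cscale (- inverse ((qpar b)^2)) (sl_F V (qH bs (sl_wt V) 1
        v))"
    using qH_shift[OF lin(1) sh(1), of bs 1] qH_shift[OF lin(2) sh(2), of bs 1] by simp_all
  have coeff: "1 / (qpar bs - inverse (qpar bs)) = \<i> / (qpar b + inverse (qpar b))"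
  proof -
    have "qpar bs - inverse (qpar bs) = - \<i> * (qpar b + inverse (qpar b))"
      by (simp add: qpar_bs field_simps)
    then show ?thesis by (simp only:) (simp del: distrib_left_numeral add: divide_inverse)
  qed
  have EF': "sl_E V (sl_F V v) = cscale (\<i> / (qpar b + inverse (qpar b)))
          (qH bs (sl_wt V) 1 v - qH bs (sl_wt V) (- 1) v) + sl_F V (sl_E V v)" for v
    using EF[of v] by (simp add: coeff algebra_simps)
  have even: "even_map (par ?T) (par ?T) (XE ?T)"
    unfolding even_map_iff[OF lin'(1)] by (rule tens_ext_all) (simp_all add: clinear_map_iff tensor)
  have odd: "odd_map (par ?T) (par ?T) (EE ?T)" "odd_map (par ?T) (par ?T) (FF ?T)"
    unfolding odd_map_iff[OF lin'(2)] odd_map_iff[OF lin'(3)]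
    by (rule tens_ext_all; simp add: clinear_map_iff tensor)+
  have shift: "shifts_weight (wt ?T) (XE ?T) 0" "shifts_weight (wt ?T) (EE ?T) 2"
    "shifts_weight (wt ?T) (FF ?T) (- 2)"
    unfolding shifts_weight_iff[OF lin'(1)] shifts_weight_iff[OF lin'(2)] shifts_weight_iff[OF
        lin'(3)]
    by (rule tens_ext_all; simp add: clinear_map_iff tensor vec.scale_right_distrib
        vec.scale_right_diff_distrib wtV algebra_simps)+
  have rel: "\<forall>v. XE ?T (XE ?T v) = - v"
    "\<forall>v. XE ?T (EE ?T v) = - EE ?T (XE ?T v)" "\<forall>v. XE ?T (FF ?T v) = - FF ?T (XE ?T v)"
    by (rule tens_ext_all; simp add: clinear_map_iff tensor)+
  have EF: "\<forall>v. EE ?T (FF ?T v) + FF ?T (EE ?T v) =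
      cscale (1 / (qpar b + inverse (qpar b))) (KK bs ?T v - KK_inv bs ?T v)"
    by (rule tens_ext_all) (simp_all add: clinear_map_iff tensor EF' vec.scale_right_distrib
        vec.scale_right_diff_distrib algebra_simps)
  have KEF: "\<forall>v. KK bs ?T (EE ?T v) = cscale ((qpar b)^2) (EE ?T (KK bs ?T v))"
     "\<forall>v. KK bs ?T (FF ?T v) = cscale (inverse ((qpar b)^2)) (FF ?T (KK bs ?T v))"
    by (rule tens_ext_all; simp add: clinear_map_iff tensor qHV vec.scale_right_distrib
        vec.scale_right_diff_distrib mult.commute)+
  have "locally_nilpotent (EE ?T)"
    by (simp add: tensor locally_nilpotent_tmap nil)
  then show ?thesis
    unfolding osp_weight_module_def using lin' even odd shift rel EF KEF by blast
qed

section \<open>The quasi-R-matrix\<close>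

text \<open>The exponent \<open>Y\<close>. The odd \<F> makes \<open>\<E> \<otimes> \<F>\<close> act
  as \<open>\<E> \<sigma> \<otimes> \<F>\<close>.\<close>

definition EF_op :: "complex \<Rightarrow> 'i osp_module \<Rightarrow> 'j osp_module \<Rightarrow> ('i \<times> 'j) vec \<Rightarrow> ('i \<times> 'j) vec" where
  "EF_op b M N v = cscale (- (qpar b + inverse (qpar b))) (tmap (EE M \<circ> sg (par M)) (FF N) v)"

lemma clinear_EF_op [simp]: "clinear_map (EF_op b M N)"
  by (simp add: clinear_map_iff EF_op_def vec.scale_right_distrib mult.commute)

lemmas EF_op_simps [simp] = clinear_map_simps[OF clinear_EF_op]

text \<open>The exponents \<open>n (n - 1) / 2\<close> use division of natural numbers, which is
  exact because \<open>n (n - 1)\<close> is even.\<close>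

lemma triangle_Suc: "Suc n * n div 2 = n * (n - 1) div 2 + n"
proof -
  have "even (n * (n - 1))" by (cases n) auto
  moreover have "Suc n * n = n * (n - 1) + 2 * n" by (cases n) (auto simp: algebra_simps)
  ultimately show ?thesis by auto
qed

context osp_params
begin

lemma minus_q_plus_inverse_cancel [simp]:
  "(- qpar b - inverse (qpar b)) / (qpar b + inverse (qpar b)) = - 1"
proof -
  have "- qpar b - inverse (qpar b) = - (qpar b + inverse (qpar b))" by simp
  then show ?thesis by (simp only: minus_divide_left[symmetric] divide_self[OF
      q_plus_inverse_neq_0])
qed

text \<open>Since \<open>1 - p = (q + q^-1) / q\<close>, both kinds of quantum numbers have the
  denominator \<open>q + q^-1\<close>, and they differ by a power of \<open>- q\<close>.\<close>

lemma brace_Suc: "brace (qpar b) (Suc n) = (- 1) ^ n * qpar b ^ n * qnum p (Suc n)"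
proof -
  have 1: "1 - p = (qpar b + inverse (qpar b)) / qpar b"
    by (simp add: field_simps power2_eq_square)
  have 2: "p ^ Suc n = (- 1) ^ Suc n * inverse (qpar b) ^ Suc n / qpar b ^ Suc n"
    by (subst power_minus) (simp add: power2_eq_square power_mult_distrib divide_inverse
        power_inverse)
  have 3: "(- 1) ^ n * (- 1) ^ n = (1 :: complex)"
    by (simp flip: power_mult_distrib)
  have "(- 1) ^ n * qpar b ^ n * qnum p (Suc n)
      = ((- 1) ^ n * qpar b ^ Suc n - (- 1) ^ n * qpar b ^ Suc n * p ^ Suc n) / (qpar b + inverse
          (qpar b))"
    unfolding qnum_def 1 by (simp add: field_simps del: q_plus_inverse_neq_0)
  also have "(- 1) ^ n * qpar b ^ Suc n * p ^ Suc n = - ((- 1) ^ n * (- 1) ^ n) * inverse (qpar b)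
      ^ Suc n"
    unfolding 2 by (simp add: field_simps)
  finally show ?thesis by (simp add: 3 brace_def)
qed

lemma brace_fact_eq:
  "brace_fact (qpar b) n = (- 1) ^ (n * (n - 1) div 2) * qpar b ^ (n * (n - 1) div 2) * qnum_fact
      p n"
proof (induction n)
  case (Suc n)
  have "brace_fact (qpar b) (Suc n) = brace_fact (qpar b) n * brace (qpar b) (Suc n)"
    by (simp add: brace_fact_def)
  then show ?case
    by (simp only: Suc brace_Suc qnum_fact_Suc diff_Suc_1 triangle_Suc power_add) (simp only:
        mult_ac)
qed (simp add: brace_fact_def)

text \<open>The sign on the left is the one by which the n-th power of
  \<open>\<E> \<otimes> \<F>\<close> differs from \<open>\<E>^n \<otimes> \<F>^n\<close>. Including
  it turns \<open>a_coeff\<close> into a coefficient of the q-exponential.\<close>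

lemma a_coeff_eq:
  "a_coeff (qpar b) n * (- 1) ^ (n * (n - 1) div 2) = (- (qpar b + inverse (qpar b))) ^ n /
      qnum_fact p n"
proof -
  define m where "m = n * (n - 1) div 2"
  have 3: "(- 1) ^ m * (- 1) ^ m = (1 :: complex)"
    by (simp flip: power_mult_distrib)
  have 4: "(- 1) ^ m = (1 :: complex) \<or> (- 1) ^ m = (- 1 :: complex)"
    by (cases "even m") simp_all
  show ?thesis
    unfolding a_coeff_def brace_fact_eq m_def[symmetric] power_minus[of "qpar b + inverse (qpar b)"]
    using 4 by (auto simp: field_simps simp del: q_plus_inverse_neq_0)
qed

end

context osp_weight
begin

lemma sg_funpow_FF: "sg (par M) ((FF M ^^ n) v) = cscale ((- 1) ^ n) ((FF M ^^ n) (sg (par M) v))"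
  by (induction n) simp_all

text \<open>Moving all \<sigma> to the right costs one sign for each \<E> that is passed,
  \<open>0 + 1 + ... + (n - 1)\<close> in total.\<close>

lemma funpow_EE_sg: "((EE M \<circ> sg (par M)) ^^ n) v
    = cscale ((- 1) ^ (n * (n - 1) div 2)) ((EE M ^^ n) ((sg (par M) ^^ n) v))"
proof (induction n)
  case (Suc n)
  have sgE: "sg (par M) ((EE M ^^ k) w) = cscale ((- 1) ^ k) ((EE M ^^ k) (sg (par M) w))" for k w
    by (induction k) simp_all
  show ?case
    unfolding funpow.simps o_apply[of "EE M \<circ> sg (par M)"] Suc
    by (simp add: sgE triangle_Suc[unfolded mult_Suc] power_add)
qed simp

text \<open>The powers of \<sigma> take \<open>v\<close> only to \<open>v\<close> and
  \<open>\<sigma> v\<close>, so a common bound for \<E> at these two vectors suffices.\<close>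

lemma nilpotent_EE_sg: "locally_nilpotent (EE M \<circ> sg (par M))"
  unfolding locally_nilpotent_def
proof
  fix v
  note [simp] = clinear_map_simps[OF clinear_map_funpow[OF clinear_EE]]
  obtain N where N: "\<And>n w. n \<ge> N \<Longrightarrow> w \<in> {v, sg (par M) v} \<Longrightarrow> (EE M ^^ n) w = 0"
    using locally_nilpotentD[OF nilpotent_EE clinear_EE, of "{v, sg (par M) v}"] by auto
  have "(sg (par M) ^^ n) v \<in> {v, sg (par M) v}" for n
    by (induction n) auto
  then have "((EE M \<circ> sg (par M)) ^^ N) v = 0"
    using N by (simp add: funpow_EE_sg)
  then show "\<exists>n. ((EE M \<circ> sg (par M)) ^^ n) v = 0" ..
qed

end

text \<open>\<open>\<F>^n\<close> has the parity of \<open>n\<close> and so contributes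
  \<open>\<sigma>^n\<close> to the first factor. Redistributing these operators among the factors
  \<E> gives the sign of \<open>funpow_EE_sg\<close>.\<close>

lemma stensor_funpow:
  assumes "osp_weight b bs M" "osp_weight b bs N"
  shows "stensor M N (EE M ^^ n) (FF N ^^ n) v
    = cscale ((- 1) ^ (n * (n - 1) div 2)) ((tmap (EE M \<circ> sg (par M)) (FF N) ^^ n) v)"
proof -
  interpret M: osp_weight b bs M by fact
  interpret N: osp_weight b bs N by fact
  have sgn: "sg (par M) ^^ n = (if even n then id else sg (par M))"
    by (induction n) (auto simp: fun_eq_iff)
  have st: "stensor M N (EE M ^^ n) (FF N ^^ n) = tmap (EE M ^^ n \<circ> sg (par M) ^^ n) (FF N ^^ n)"
  proof (cases "even n")
    case True
    then have "even_map (par N) (par N) (FF N ^^ n)" by (simp add: even_map_iff N.sg_funpow_FF)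
    then show ?thesis using True by (simp add: super_tensor_even sgn)
  next
    case False
    then have "odd_map (par N) (par N) (FF N ^^ n)" by (simp add: odd_map_iff N.sg_funpow_FF)
    then show ?thesis using False by (simp add: super_tensor_odd sgn)
  qed
  have "stensor M N (EE M ^^ n) (FF N ^^ n) =
    (\<lambda>v. cscale ((- 1) ^ (n * (n - 1) div 2)) ((tmap (EE M \<circ> sg (par M)) (FF N) ^^ n) v))"
    unfolding st
    by (rule tens_ext) (simp_all add: tmap_funpow_tens M.funpow_EE_sg flip: power_mult_distrib)
  then show ?thesis by simp
qed

lemma funpow_cscale:
  fixes T :: "'i vec \<Rightarrow> 'i vec"
  assumes "clinear_map T"
  shows "((\<lambda>v. cscale c (T v)) ^^ n) v = cscale (c ^ n) ((T ^^ n) v)"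
  by (induction n) (simp_all add: clinear_map_simps[OF assms])

section \<open>The quasi-R-matrix on a pair of modules\<close>

context osp_weight2
begin

lemma EF_op_eq: "(\<lambda>v. cscale (- (qpar b + inverse (qpar b))) (stensor M N (EE M) (FF N) v)) =
    EF_op b M N"
  by (simp add: fun_eq_iff EF_op_def super_tensor_odd[OF N.odd_FF])

lemma EF_op_eq': "(\<lambda>v. cscale (\<i> * (inverse (qpar bs) - qpar bs)) (stensor M N (EE M) (FF N) v)) =
    EF_op b M N"
proof -
  have "\<i> * (inverse (qpar bs) - qpar bs) = - (qpar b + inverse (qpar b))"
    by (simp add: M.qpar_bs field_simps)
  then show ?thesis by (simp only: EF_op_eq)
qed

lemma inverse_qpar_bs: "inverse ((qpar bs)^2) = M.p"
  by (simp add: M.qpar_bs power_mult_distrib)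

lemma calR_eq: "calR bs M N = qexp M.p (EF_op b M N)"
  by (simp only: calR_def EF_op_eq' inverse_qpar_bs)

lemma nilpotent_EF_tmap: "locally_nilpotent (tmap (EE M \<circ> sg (par M)) (FF N))"
  by (simp add: locally_nilpotent_tmap M.nilpotent_EE_sg)

lemma nilpotent_EF_op: "locally_nilpotent (EF_op b M N)"
  unfolding EF_op_def[abs_def] by (simp add: locally_nilpotent_cscale nilpotent_EF_tmap)

lemma calR_eq_R_series: "calR bs M N = R_series b M N"
proof
  fix v
  show "calR bs M N v = R_series b M N v"
    unfolding calR_eq R_series_def qexp_def EF_op_def[abs_def] funpow_cscale[OF clinear_tmap]
      stensor_funpow[OF M.osp_weight_axioms N.osp_weight_axioms]
    by (simp only: vec.scale_scale M.a_coeff_eq) (simp only: times_divide_eq_left mult_1)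
qed

lemma clinear_calR [simp]: "clinear_map (calR bs M N)"
  unfolding calR_eq qexp_eq_ser by (rule clinear_ser) (simp_all add: nilpotent_EF_op)

lemma bij_calR: "bij (calR bs M N)"
  unfolding calR_eq qexp_eq_ser by (rule bij_ser) (simp_all add: nilpotent_EF_op)

lemma calR_transport:
  assumes "clinear_map T" "\<And>v. T (EF_op b M N v) = Y (T v)"
  shows "T (calR bs M N v) = qexp M.p Y (T v)"
  unfolding calR_eq qexp_eq_ser by (rule ser_transport) (simp_all add: assms nilpotent_EF_op)

text \<open>The case \<open>f = \<sigma> \<otimes> \<E>\<close>,
  \<open>e = \<E> \<otimes> \<K>\<close>, \<open>e' = \<E> \<otimes> \<K>^-1\<close> of
  \<open>qexp_intertwine\<close>. The commutator of \<open>Y\<close> and \<open>f\<close> contains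
  the anticommutator of \<E> and \<F> in the second factor, whose denominator cancels the scalar of
  \<open>Y\<close>.\<close>

lemma calR_intertwines_E:
  "calR bs M N (tmap (sg (par M)) (EE N) v + tmap (EE M) (KK bs N) v)
   = tmap (sg (par M)) (EE N) (calR bs M N v) + tmap (EE M) (KK_inv bs N) (calR bs M N v)"
  unfolding calR_eq
proof (rule M.qexp_intertwine)
  have "\<forall>v. EF_op b M N (tmap (sg (par M)) (EE N) v)
     = tmap (sg (par M)) (EE N) (EF_op b M N v) + tmap (EE M) (KK_inv bs N) v - tmap (EE M) (KK bs
         N) v"
    by (rule tens_ext_all; simp add: clinear_map_iff vec.scale_right_distrib
        vec.scale_right_diff_distrib
        EF_op_def mult.commute; rule vec_eqI; simp add: lookup_vec)
  then show "EF_op b M N (tmap (sg (par M)) (EE N) v)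
     = tmap (sg (par M)) (EE N) (EF_op b M N v) + tmap (EE M) (KK_inv bs N) v - tmap (EE M) (KK bs
         N) v" for v
    by blast
  have "\<forall>v. tmap (EE M) (KK bs N) (EF_op b M N v) = cscale M.p (EF_op b M N (tmap (EE M) (KK bs N)
      v))"
    by (rule tens_ext_all) (simp_all add: clinear_map_iff vec.scale_right_distrib EF_op_def mult_ac)
  then show "tmap (EE M) (KK bs N) (EF_op b M N v) = cscale M.p (EF_op b M N (tmap (EE M) (KK bs
      N) v))" for v
    by blast
  have "\<forall>v. EF_op b M N (tmap (EE M) (KK_inv bs N) v) = cscale M.p (tmap (EE M) (KK_inv bs N)
      (EF_op b M N v))"
    by (rule tens_ext_all) (simp_all add: clinear_map_iff vec.scale_right_distrib EF_op_def mult_ac)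
  then show "EF_op b M N (tmap (EE M) (KK_inv bs N) v) = cscale M.p (tmap (EE M) (KK_inv bs N)
      (EF_op b M N v))" for v
    by blast
qed (simp_all add: nilpotent_EF_op)

text \<open>Likewise with \<open>f = \<F> \<otimes> 1\<close>,
  \<open>e = \<K>^-1 \<sigma> \<otimes> \<F>\<close> and
  \<open>e' = \<K> \<sigma> \<otimes> \<F>\<close>; the anticommutator now arises in the first
  factor.\<close>

lemma calR_intertwines_F:
  "calR bs M N (tmap (FF M) id v + tmap (KK_inv bs M \<circ> sg (par M)) (FF N) v)
   = tmap (FF M) id (calR bs M N v) + tmap (KK bs M \<circ> sg (par M)) (FF N) (calR bs M N v)"
  unfolding calR_eq
proof (rule M.qexp_intertwine)
  have "\<forall>v. EF_op b M N (tmap (FF M) id v)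
     = tmap (FF M) id (EF_op b M N v) + tmap (KK bs M \<circ> sg (par M)) (FF N) v
       - tmap (KK_inv bs M \<circ> sg (par M)) (FF N) v"
    by (rule tens_ext_all; simp add: clinear_map_iff vec.scale_right_distrib
        vec.scale_right_diff_distrib
        EF_op_def mult.commute; rule vec_eqI; simp add: lookup_vec)
  then show "EF_op b M N (tmap (FF M) id v)
     = tmap (FF M) id (EF_op b M N v) + tmap (KK bs M \<circ> sg (par M)) (FF N) v
       - tmap (KK_inv bs M \<circ> sg (par M)) (FF N) v" for v
    by blast
  have "\<forall>v. tmap (KK_inv bs M \<circ> sg (par M)) (FF N) (EF_op b M N v)
      = cscale M.p (EF_op b M N (tmap (KK_inv bs M \<circ> sg (par M)) (FF N) v))"
    by (rule tens_ext_all) (simp_all add: clinear_map_iff vec.scale_right_distrib EF_op_def mult_ac)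
  then show "tmap (KK_inv bs M \<circ> sg (par M)) (FF N) (EF_op b M N v)
      = cscale M.p (EF_op b M N (tmap (KK_inv bs M \<circ> sg (par M)) (FF N) v))" for v
    by blast
  have "\<forall>v. EF_op b M N (tmap (KK bs M \<circ> sg (par M)) (FF N) v)
      = cscale M.p (tmap (KK bs M \<circ> sg (par M)) (FF N) (EF_op b M N v))"
    by (rule tens_ext_all) (simp_all add: clinear_map_iff vec.scale_right_distrib EF_op_def mult_ac)
  then show "EF_op b M N (tmap (KK bs M \<circ> sg (par M)) (FF N) v)
      = cscale M.p (tmap (KK bs M \<circ> sg (par M)) (FF N) (EF_op b M N v))" for v
    by blast
qed (simp_all add: nilpotent_EF_op)

text \<open>\<open>Y\<close> has weight zero and is even, so it commutes with all three
  operators.\<close>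

lemma calR_intertwines_K:
  "calR bs M N (tmap (KK bs M) (KK bs N) v) = tmap (KK bs M) (KK bs N) (calR bs M N v)"
  "calR bs M N (tmap (KK_inv bs M) (KK_inv bs N) v) = tmap (KK_inv bs M) (KK_inv bs N) (calR bs M
      N v)"
  "calR bs M N (tmap (sg (par M)) (sg (par N)) v) = tmap (sg (par M)) (sg (par N)) (calR bs M N v)"
proof -
  have 1: "\<forall>v. tmap (KK bs M) (KK bs N) (EF_op b M N v) = EF_op b M N (tmap (KK bs M) (KK bs N) v)"
    and 2: "\<forall>v. tmap (KK_inv bs M) (KK_inv bs N) (EF_op b M N v) = EF_op b M N (tmap (KK_inv bs M)
        (KK_inv bs N) v)"
    and 3: "\<forall>v. tmap (sg (par M)) (sg (par N)) (EF_op b M N v) = EF_op b M N (tmap (sg (par M))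
        (sg (par N)) v)"
    by (rule tens_ext_all; simp add: clinear_map_iff vec.scale_right_distrib EF_op_def mult_ac)+
  show "calR bs M N (tmap (KK bs M) (KK bs N) v) = tmap (KK bs M) (KK bs N) (calR bs M N v)"
    using calR_transport[of "tmap (KK bs M) (KK bs N)" "EF_op b M N" v] 1 by (simp add: calR_eq)
  show "calR bs M N (tmap (KK_inv bs M) (KK_inv bs N) v) = tmap (KK_inv bs M) (KK_inv bs N) (calR
      bs M N v)"
    using calR_transport[of "tmap (KK_inv bs M) (KK_inv bs N)" "EF_op b M N" v] 2 by (simp add:
        calR_eq)
  show "calR bs M N (tmap (sg (par M)) (sg (par N)) v) = tmap (sg (par M)) (sg (par N)) (calR bs M
      N v)"
    using calR_transport[of "tmap (sg (par M)) (sg (par N))" "EF_op b M N" v] 3 by (simp add: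
        calR_eq)
qed

end

section \<open>The R-matrix\<close>

lemma diag_tmap_intertwine:
  assumes "clinear_map A" "clinear_map B"
    and "\<And>i j k l. k \<in> Poly_Mapping.keys (A (basis_vec i)) \<Longrightarrow> l \<in> Poly_Mapping.keys (B (basis_vec j))
      \<Longrightarrow> f (k, l) = g (i, j)"
  shows "diag f (tmap A B v) = tmap A B (diag g v)"
proof -
  have "\<forall>x. \<forall>y\<in>Poly_Mapping.keys (tmap A B (basis_vec x)). f y = g x"
    using assms by (auto simp: in_keys_iff lookup_tens simp flip: tens_basis_vec)
  then show ?thesis
    unfolding diag_intertwine_iff[OF clinear_tmap] by blast
qed

lemma keys_basis_vec [simp]: "Poly_Mapping.keys (basis_vec i) = {i}"
  by (simp add: basis_vec_def)

lemma tmap_id_diag: "tmap id (diag g) = diag (\<lambda>(i, j). g j)" "tmap (diag g) id = diag (\<lambda>(i, j). g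
    i)"
  by (rule clinear_map_basis_ext; auto simp flip: tens_basis_vec)+

lemma qHH_eq_diag: "qHH bs M N = diag (\<lambda>(i, j). qpow bs (wt M i * wt N j / 2))"
  unfolding qHH_def diag_def by (intro arg_cong[of _ _ lin_ext]) auto

lemma clinear_qHH [simp]: "clinear_map (qHH bs M N)"
  by (simp add: qHH_eq_diag)

lemmas qHH_simps [simp] = clinear_map_simps[OF clinear_qHH]

lemma bij_qHH: "bij (qHH bs M N)"
proof (rule o_bij)
  let ?g = "diag (\<lambda>(i, j). inverse (qpow bs (wt M i * wt N j / 2)))"
  have *: "(\<lambda>x. (case x of (i, j) \<Rightarrow> qpow bs (wt M i * wt N j / 2)) *
      (case x of (i, j) \<Rightarrow> inverse (qpow bs (wt M i * wt N j / 2)))) = (\<lambda>_. 1)"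
    by auto
  show "?g \<circ> qHH bs M N = id" "qHH bs M N \<circ> ?g = id"
    by (simp_all add: fun_eq_iff qHH_eq_diag diag_diag * mult.commute[of "case _ of (i, j) \<Rightarrow>
        inverse (_ i j)"] diag_one)
qed

text \<open>Raising the first weight by \<open>d\<close> multiplies the eigenvalue by
  \<open>q\<^sub>*^(d H / 2)\<close> of the second factor. For \<E> and \<F>, with
  \<open>d = 2\<close> and \<open>d = - 2\<close>, this is the Cartan part of \<K> and of its
  inverse.\<close>

lemma qHH_left:
  assumes "clinear_map A" "shifts_weight (wt M) A d"
  shows "qHH bs M N (tmap A id v) = tmap A (qH bs (wt N) (d / 2)) (qHH bs M N v)"
proof -
  have "qHH bs M N (tmap A id v)
      = tmap A id (diag (\<lambda>(i, j). qpow bs (d / 2 * wt N j) * qpow bs (wt M i * wt N j / 2)) v)"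
    unfolding qHH_eq_diag
    by (rule diag_tmap_intertwine)
       (use assms in \<open>auto simp: shifts_weight_def field_simps simp flip: qpow_add\<close>)
  also have "diag (\<lambda>(i, j). qpow bs (d / 2 * wt N j) * qpow bs (wt M i * wt N j / 2)) v
      = tmap id (qH bs (wt N) (d / 2)) (qHH bs M N v)"
    by (simp add: qHH_eq_diag qH_eq_diag tmap_id_diag diag_diag case_prod_unfold)
  also have "tmap A id (tmap id (qH bs (wt N) (d / 2)) (qHH bs M N v))
      = tmap A (qH bs (wt N) (d / 2)) (qHH bs M N v)"
    by (simp add: tmap_comp assms(1))
  finally show ?thesis .
qed

lemma qHH_right:
  assumes "clinear_map B" "shifts_weight (wt N) B d"
  shows "qHH bs M N (tmap id B v) = tmap (qH bs (wt M) (d / 2)) B (qHH bs M N v)"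
proof -
  have "qHH bs M N (tmap id B v)
      = tmap id B (diag (\<lambda>(i, j). qpow bs (d / 2 * wt M i) * qpow bs (wt M i * wt N j / 2)) v)"
    unfolding qHH_eq_diag
    by (rule diag_tmap_intertwine)
       (use assms in \<open>auto simp: shifts_weight_def field_simps simp flip: qpow_add\<close>)
  also have "diag (\<lambda>(i, j). qpow bs (d / 2 * wt M i) * qpow bs (wt M i * wt N j / 2)) v
      = tmap (qH bs (wt M) (d / 2)) id (qHH bs M N v)"
    by (simp add: qHH_eq_diag qH_eq_diag tmap_id_diag diag_diag case_prod_unfold)
  also have "tmap id B (tmap (qH bs (wt M) (d / 2)) id (qHH bs M N v))
      = tmap (qH bs (wt M) (d / 2)) B (qHH bs M N v)"
    by (simp add: tmap_comp assms(1))
  finally show ?thesis .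
qed

lemma shifts_weight_id: "shifts_weight h id 0"
  by (simp add: shifts_weight_def)

lemma shifts_weight_diag: "shifts_weight h (diag f) 0"
  by (auto simp: shifts_weight_def in_keys_iff lookup_diag lookup_basis_vec lookup_cscale split:
      if_splits)

section \<open>The sign factor \<open>C\<close>\<close>

lemma clinear_C_op [simp]: "clinear_map (C_op p1 p2 X Y)"
  by (simp add: clinear_map_iff C_op_def clinear_map_simps[OF clinear_super_tensor]
      vec.scale_right_distrib mult.commute)

lemmas C_op_simps [simp] = clinear_map_simps[OF clinear_C_op]

lemma C_op_tens:
  assumes "clinear_map X" "clinear_map Y" "even_map p2 p2 Y"
  shows "C_op p1 p2 X Y (tens v w) = cscale (1/2) (tens v w + cscale \<i> (tens (X v) w)
      + cscale \<i> (tens v (Y w)) + tens (X v) (Y w))"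
proof -
  note [simp] = clinear_map_simps[OF assms(2)]
  have even: "even_map p2 p2 (\<lambda>u. cscale \<i> (Y u))"
    using assms by (simp add: even_map_iff)
  show ?thesis
    using assms by (simp add: C_op_def super_tensor_even even even_map_id)
qed

text \<open>If \<open>\<i> \<xi>\<eta>\<close> has eigenvalues \<open>s\<close> and \<open>t\<close>
  on the two factors, then \<open>C\<close> is \<open>(1 + s + t - s t) / 2\<close>, which is -1 for
  \<open>s = t = -1\<close> and 1 otherwise.\<close>

lemma C_op_cliff:
  "C_op id id (cliff_xi \<circ> cliff_eta) (cliff_xi \<circ> cliff_eta) (basis_vec (\<epsilon>1, \<epsilon>2))
   = cscale ((- 1) ^ (of_bool \<epsilon>1 * of_bool \<epsilon>2)) (basis_vec (\<epsilon>1, \<epsilon>2))"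
proof -
  have "even_map id id (cliff_xi \<circ> cliff_eta)"
    by (simp add: even_map_iff)
  then show ?thesis
    by (cases \<epsilon>1; cases \<epsilon>2; simp add: C_op_tens cliff_basis_vec flip: tens_basis_vec)
       (rule vec_eqI; simp add: lookup_vec)+
qed

context osp_weight2
begin

lemma C_tens: "C_op (par M) (par N) (XE M) (XE N) (tens v w) =
    cscale (1/2) (tens v w + cscale \<i> (tens (XE M v) w) + cscale \<i> (tens v (XE N w)) + tens (XE M
        v) (XE N w))"
  by (simp add: C_op_tens N.even_XE)

text \<open>\<open>C\<close> is the sign of two commuting involutions
  \<open>\<i> \<xi>\<eta>\<close>, hence an involution itself.\<close>

lemma C_C [simp]: "C_op (par M) (par N) (XE M) (XE N) (C_op (par M) (par N) (XE M) (XE N) v) = v"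
proof -
  have "\<forall>v. C_op (par M) (par N) (XE M) (XE N) (C_op (par M) (par N) (XE M) (XE N) v) = v"
    by (rule tens_ext_all; simp add: clinear_map_iff C_tens) (rule vec_eqI, simp add: lookup_vec
        field_simps)
  then show ?thesis ..
qed

text \<open>Odd and even refer here to anticommuting and commuting with \<xi>\<eta>. Changing the
  sign of \<open>s\<close> in \<open>(1 + s + t - s t) / 2\<close> multiplies it by
  \<open>t\<close>, which is \<open>\<i> \<xi>\<eta>\<close> on the second factor.\<close>

lemma C_odd_even:
  assumes "clinear_map A" "clinear_map B"
    and "\<And>v. XE M (A v) = - A (XE M v)" "\<And>v. XE N (B v) = B (XE N v)"
  shows "C_op (par M) (par N) (XE M) (XE N) (tmap A B v)
    = tmap A (\<lambda>w. cscale \<i> (XE N (B w))) (C_op (par M) (par N) (XE M) (XE N) v)"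
proof -
  note [simp] = clinear_map_simps[OF assms(1)] clinear_map_simps[OF assms(2)] assms
  have [simp]: "clinear_map (\<lambda>w. cscale \<i> (B (XE N w)))"
    by (simp add: clinear_map_iff vec.scale_right_distrib mult.commute)
  have "\<forall>v. C_op (par M) (par N) (XE M) (XE N) (tmap A B v)
    = tmap A (\<lambda>w. cscale \<i> (XE N (B w))) (C_op (par M) (par N) (XE M) (XE N) v)"
    by (rule tens_ext_all; simp add: clinear_map_iff C_tens)
  then show ?thesis ..
qed

lemma C_even_odd:
  assumes "clinear_map A" "clinear_map B"
    and "\<And>v. XE M (A v) = A (XE M v)" "\<And>v. XE N (B v) = - B (XE N v)"
  shows "C_op (par M) (par N) (XE M) (XE N) (tmap A B v)
    = tmap (\<lambda>w. cscale \<i> (XE M (A w))) B (C_op (par M) (par N) (XE M) (XE N) v)"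
proof -
  note [simp] = clinear_map_simps[OF assms(1)] clinear_map_simps[OF assms(2)] assms
  have [simp]: "clinear_map (\<lambda>w. cscale \<i> (A (XE M w)))"
    by (simp add: clinear_map_iff vec.scale_right_distrib mult.commute)
  have "\<forall>v. C_op (par M) (par N) (XE M) (XE N) (tmap A B v)
    = tmap (\<lambda>w. cscale \<i> (XE M (A w))) B (C_op (par M) (par N) (XE M) (XE N) v)"
    by (rule tens_ext_all; simp add: clinear_map_iff C_tens)
  then show ?thesis ..
qed

lemma C_even_even:
  assumes "clinear_map A" "clinear_map B"
    and "\<And>v. XE M (A v) = A (XE M v)" "\<And>v. XE N (B v) = B (XE N v)"
  shows "C_op (par M) (par N) (XE M) (XE N) (tmap A B v)
    = tmap A B (C_op (par M) (par N) (XE M) (XE N) v)"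
proof -
  note [simp] = clinear_map_simps[OF assms(1)] clinear_map_simps[OF assms(2)] assms
  have "\<forall>v. C_op (par M) (par N) (XE M) (XE N) (tmap A B v) = tmap A B (C_op (par M) (par N) (XE
      M) (XE N) v)"
    by (rule tens_ext_all; simp add: clinear_map_iff C_tens)
  then show ?thesis ..
qed

section \<open>Conjugation by \<open>Q\<close>, and invertibility of the R-matrix\<close>

lemma clinear_Q_op [simp]: "clinear_map (Q_op bs M N)"
  by (simp add: Q_op_def)

lemmas Q_op_simps [simp] = clinear_map_simps[OF clinear_Q_op]

lemma bij_Q_op: "bij (Q_op bs M N)"
  unfolding Q_op_def by (rule bij_comp[OF bij_qHH]) (rule involuntory_imp_bij, simp)

lemma Q_even_even:
  assumes "clinear_map A" "clinear_map B"
    and "shifts_weight (wt M) A 0" "shifts_weight (wt N) B 0"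
    and "\<And>v. XE M (A v) = A (XE M v)" "\<And>v. XE N (B v) = B (XE N v)"
  shows "Q_op bs M N (tmap A B v) = tmap A B (Q_op bs M N v)"
proof -
  have "qHH bs M N (tmap A id (tmap id B v)) = tmap A id (tmap id B (qHH bs M N v))"
    unfolding qHH_left[OF assms(1,3)] qHH_right[OF assms(2,4)]
    by (simp add: tmap_comp assms(1,2) comp_def id_def)
  then show ?thesis
    by (simp add: Q_op_def C_even_even tmap_comp assms)
qed

lemma shift_sg: "shifts_weight (wt M) (sg (par M)) 0" "shifts_weight (wt N) (sg (par N)) 0"
  by (simp_all add: sg_def shifts_weight_diag)

lemma shift_KK: "shifts_weight (wt M) (KK bs M) 0" "shifts_weight (wt M) (KK_inv bs M) 0"
  "shifts_weight (wt N) (KK bs N) 0" "shifts_weight (wt N) (KK_inv bs N) 0"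
  using M.shift_XE N.shift_XE
  by (simp_all add: shifts_weight_iff KK_def KK_inv_def qH_eq_diag diag_diag mult.commute)

lemma Q_sg: "Q_op bs M N (tmap (sg (par M)) id v) = tmap (sg (par M)) id (Q_op bs M N v)"
  "Q_op bs M N (tmap id (sg (par N)) v) = tmap id (sg (par N)) (Q_op bs M N v)"
  "Q_op bs M N (tmap (sg (par M)) (sg (par N)) v) = tmap (sg (par M)) (sg (par N)) (Q_op bs M N v)"
  by (rule Q_even_even; simp add: shift_sg shifts_weight_id)+

lemma Q_KK:
  "Q_op bs M N (tmap (KK bs M) (KK bs N) v) = tmap (KK bs M) (KK bs N) (Q_op bs M N v)"
  "Q_op bs M N (tmap (KK_inv bs M) (KK_inv bs N) v) = tmap (KK_inv bs M) (KK_inv bs N) (Q_op bs M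
      N v)"
  "Q_op bs M N (tmap (KK bs M) id v) = tmap (KK bs M) id (Q_op bs M N v)"
  "Q_op bs M N (tmap id (KK_inv bs N) v) = tmap id (KK_inv bs N) (Q_op bs M N v)"
  by (rule Q_even_even; simp add: shift_KK shifts_weight_id)+

text \<open>On the other tensor factor \<open>qHH\<close> contributes a power of
  \<open>q\<^sub>*^H\<close> and \<open>C\<close> contributes \<open>\<i> \<xi>\<eta>\<close>;
  together they form \<K> or its inverse.\<close>

lemma Q_left:
  "Q_op bs M N (tmap (EE M) id v) = tmap (EE M) (KK bs N) (Q_op bs M N v)"
  "Q_op bs M N (tmap (FF M) id v) = tmap (FF M) (KK_inv bs N) (Q_op bs M N v)"
  unfolding Q_op_def o_apply qHH_left[OF M.clinear_EE M.shift_EE] qHH_left[OF M.clinear_FF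
      M.shift_FF]
  by (simp_all add: C_odd_even KK_def[abs_def] KK_inv_def[abs_def])

lemma Q_right:
  "Q_op bs M N (tmap id (EE N) v) = tmap (KK bs M) (EE N) (Q_op bs M N v)"
  "Q_op bs M N (tmap id (FF N) v) = tmap (KK_inv bs M) (FF N) (Q_op bs M N v)"
  unfolding Q_op_def o_apply qHH_right[OF N.clinear_EE N.shift_EE] qHH_right[OF N.clinear_FF
      N.shift_FF]
  by (simp_all add: C_even_odd KK_def[abs_def] KK_inv_def[abs_def])

lemma Q_E_KK_inv: "Q_op bs M N (tmap (EE M) (KK_inv bs N) v) = tmap (EE M) id (Q_op bs M N v)"
proof -
  have [simp]: "KK bs N \<circ> KK_inv bs N = id"
    by (simp add: fun_eq_iff)
  have "Q_op bs M N (tmap (EE M) (KK_inv bs N) v) = Q_op bs M N (tmap (EE M) id (tmap id (KK_inv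
      bs N) v))"
    by (simp add: tmap_comp)
  also have "\<dots> = tmap (EE M) id (Q_op bs M N v)"
    unfolding Q_left Q_KK by (simp add: tmap_comp)
  finally show ?thesis .
qed

lemma Q_Esg_KK_inv: "Q_op bs M N (tmap (EE M \<circ> sg (par M)) (KK_inv bs N) v) = tmap (EE M \<circ> sg (par
    M)) id (Q_op bs M N v)"
proof -
  have "Q_op bs M N (tmap (EE M \<circ> sg (par M)) (KK_inv bs N) v)
      = Q_op bs M N (tmap (EE M) (KK_inv bs N) (tmap (sg (par M)) id v))"
    by (simp add: tmap_comp)
  also have "\<dots> = tmap (EE M \<circ> sg (par M)) id (Q_op bs M N v)"
    unfolding Q_E_KK_inv Q_sg by (simp add: tmap_comp)
  finally show ?thesis .
qed

lemma Q_sg_E: "Q_op bs M N (tmap (sg (par M)) (EE N) v) = tmap (KK bs M \<circ> sg (par M)) (EE N) (Q_op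
    bs M N v)"
proof -
  have "Q_op bs M N (tmap (sg (par M)) (EE N) v) = Q_op bs M N (tmap id (EE N) (tmap (sg (par M))
      id v))"
    by (simp add: tmap_comp)
  also have "\<dots> = tmap (KK bs M \<circ> sg (par M)) (EE N) (Q_op bs M N v)"
    unfolding Q_right Q_sg by (simp add: tmap_comp)
  finally show ?thesis .
qed

lemma Q_KKsg_F: "Q_op bs M N (tmap (KK bs M \<circ> sg (par M)) (FF N) v) = tmap (sg (par M)) (FF N)
    (Q_op bs M N v)"
proof -
  have [simp]: "KK_inv bs M \<circ> (KK bs M \<circ> sg (par M)) = sg (par M)"
    by (simp add: fun_eq_iff)
  have "Q_op bs M N (tmap (KK bs M \<circ> sg (par M)) (FF N) v)
    = Q_op bs M N (tmap id (FF N) (tmap (KK bs M) id (tmap (sg (par M)) id v)))"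
    by (simp add: tmap_comp)
  also have "\<dots> = tmap (sg (par M)) (FF N) (Q_op bs M N v)"
    unfolding Q_right Q_sg Q_KK by (simp add: tmap_comp)
  finally show ?thesis .
qed

lemma clinear_R_matrix [simp]: "clinear_map (R_matrix bs M N)"
  by (simp add: R_matrix_def)

lemmas R_matrix_simps [simp] = clinear_map_simps[OF clinear_R_matrix]

lemma even_tmap_iff:
  assumes "clinear_map T"
  shows "even_map (\<lambda>(i, j). par M i \<noteq> par N j) (\<lambda>(i, j). par M i \<noteq> par N j) T
    \<longleftrightarrow> (\<forall>v. tmap (sg (par M)) (sg (par N)) (T v) = T (tmap (sg (par M)) (sg (par N)) v))"
  unfolding even_map_iff[OF assms] sg_tens ..

lemma even_R_matrix: "even_map (\<lambda>(i, j). par M i \<noteq> par N j) (\<lambda>(i, j). par M i \<noteq> par N j) (R_matrix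
    bs M N)"
  unfolding even_tmap_iff[OF clinear_R_matrix] by (simp add: Q_sg calR_intertwines_K R_matrix_def)

lemma invertible_even_R_matrix: "invertible_even M N (R_matrix bs M N)"
  unfolding invertible_even_def
  using clinear_R_matrix even_R_matrix bij_comp[OF bij_calR bij_Q_op] by (simp only: R_matrix_def
      simp_thms)

end

section \<open>Universality\<close>

lemma R_matrix_apply: "R_matrix bs M N v = Q_op bs M N (calR bs M N v)"
  by (simp add: R_matrix_def)

section \<open>Intertwining of the coproduct and its opposite\<close>

context osp_weight2
begin

text \<open>Obtained from the coproduct on \<open>N \<otimes> M\<close> by conjugation with the
  flip; again \<sigma> stands on the first factor wherever the second is odd.\<close>

lemma coprod_op_generators:
  "coprod_op bs M N GenE v = tmap (KK bs M \<circ> sg (par M)) (EE N) v + tmap (EE M) id v"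
  "coprod_op bs M N GenF v = tmap (sg (par M)) (FF N) v + tmap (FF M) (KK_inv bs N) v"
  "coprod_op bs M N GenK v = tmap (KK bs M) (KK bs N) v"
  "coprod_op bs M N GenKinv v = tmap (KK_inv bs M) (KK_inv bs N) v"
proof -
  interpret NM: osp_weight2 b bs N M ..
  have 1: "coprod_op bs M N GenE = (\<lambda>v. tmap (KK bs M \<circ> sg (par M)) (EE N) v + tmap (EE M) id v)"
    unfolding coprod_op_def NM.coprod_EE
    by (rule tens_ext; simp add: clinear_map_iff vec.scale_right_distrib super_flip_tens
        del: coprod.simps; (rule vec_eqI, simp add: lookup_vec field_simps)?)
  have 2: "coprod_op bs M N GenF = (\<lambda>v. tmap (sg (par M)) (FF N) v + tmap (FF M) (KK_inv bs N) v)"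
    unfolding coprod_op_def NM.coprod_FF
    by (rule tens_ext; simp add: clinear_map_iff vec.scale_right_distrib super_flip_tens
        del: coprod.simps; (rule vec_eqI, simp add: lookup_vec field_simps)?)
  have 3: "coprod_op bs M N GenK = tmap (KK bs M) (KK bs N)"
    "coprod_op bs M N GenKinv = tmap (KK_inv bs M) (KK_inv bs N)"
    unfolding coprod_op_def coprod.simps super_tensor_even[OF M.even_KK(1)] super_tensor_even[OF
        M.even_KK(2)]
    by (rule tens_ext; simp add: clinear_map_iff vec.scale_right_distrib super_flip_tens;
        (rule vec_eqI, simp add: lookup_vec field_simps)?)+
  show "coprod_op bs M N GenE v = tmap (KK bs M \<circ> sg (par M)) (EE N) v + tmap (EE M) id v"
  "coprod_op bs M N GenF v = tmap (sg (par M)) (FF N) v + tmap (FF M) (KK_inv bs N) v"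
  "coprod_op bs M N GenK v = tmap (KK bs M) (KK bs N) v"
  "coprod_op bs M N GenKinv v = tmap (KK_inv bs M) (KK_inv bs N) v"
    unfolding 1 2 3 by simp_all
qed

text \<open>The generators carry the content. Sums and products follow formally, because
  \<open>coprod_op\<close> is a conjugation by mutually inverse flips.\<close>

lemma intertwines_coprod_R_matrix: "intertwines_coprod bs M N (R_matrix bs M N)"
proof -
  have "R_matrix bs M N (coprod bs M N x v) = coprod_op bs M N x (R_matrix bs M N v)" for x v
  proof (induction x arbitrary: v)
    \<comment> \<open>First \<open>calR\<close> turns
      \<open>\<sigma> \<otimes> \<E> + \<E> \<otimes> \<K>\<close> into
      \<open>\<sigma> \<otimes> \<E> + \<E> \<otimes> \<K>^-1\<close>, then \<open>Q\<close> turns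
      this into \<open>\<K> \<sigma> \<otimes> \<E> + \<E> \<otimes> 1\<close>.\<close>
    case GenE
    show ?case
      unfolding coprod_EE coprod_op_generators R_matrix_apply
      by (subst add.commute) (simp only: calR_intertwines_E Q_op_simps Q_sg_E Q_E_KK_inv)
  next
    case GenF
    show ?case
      unfolding coprod_FF coprod_op_generators R_matrix_apply calR_intertwines_F
      by (simp only: Q_op_simps Q_KKsg_F Q_left add.commute)
  next
    case GenK
    show ?case
      unfolding coprod.simps super_tensor_even[OF N.even_KK(1)] coprod_op_generators R_matrix_apply
      by (simp only: calR_intertwines_K Q_KK)
  next
    case GenKinv
    show ?case
      unfolding coprod.simps super_tensor_even[OF N.even_KK(2)] coprod_op_generators R_matrix_apply
      by (simp only: calR_intertwines_K Q_KK)
  next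
    case (Scal c)
    show ?case by (simp add: coprod_op_def)
  next
    case (Plus x y)
    then show ?case by (simp add: coprod_op_def)
  next
    case (Times x y)
    then show ?case by (simp add: coprod_op_def)
  qed
  then show ?thesis
    by (simp add: intertwines_coprod_def fun_eq_iff)
qed

end

text \<open>Each ingredient is natural by itself: \<open>EF_op\<close> because \<open>f\<close> and
  \<open>g\<close> commute with \<E>, \<F> and the parity, \<open>qHH\<close> because they preserve
  weights, and \<open>C_op\<close> because they commute with \<xi>\<eta>.\<close>

lemma natural_at_R_matrix:
  assumes "osp_weight b bs M" "osp_weight b bs N" "osp_weight b bs M'" "osp_weight b bs N'"
  shows "natural_at M N M' N' (R_matrix bs M N) (R_matrix bs M' N')"
proof -
  interpret MN: osp_weight2 b bs M N using assms by (intro osp_weight2.intro)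
  interpret MN': osp_weight2 b bs M' N' using assms by (intro osp_weight2.intro)
  {
    fix f g v
    assume f: "osp_hom M M' f" and g: "osp_hom N N' g"
    from f g have lin: "clinear_map f" "clinear_map g" by (simp_all add: osp_hom_def)
    note [simp] = clinear_map_simps[OF lin(1)] clinear_map_simps[OF lin(2)] lin
    have even: "even_map (par N) (par N') g" "even_map (par M) (par M') f"
      using f g by (simp_all add: osp_hom_def)
    have fg [simp]: "XE M' (f v) = f (XE M v)" "EE M' (f v) = f (EE M v)"
      "XE N' (g w) = g (XE N w)" "FF N' (g w) = g (FF N w)" "sg (par M') (f v) = f (sg (par M) v)"
          for v w
      using f g even by (simp_all add: osp_hom_def fun_eq_iff even_map_iff)
    have EF: "\<forall>v. tmap f g (EF_op b M N v) = EF_op b M' N' (tmap f g v)"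
      by (rule tens_ext_all; simp add: clinear_map_iff vec.scale_right_distrib EF_op_def
          mult.commute)
    have R: "tmap f g (calR bs M N v) = calR bs M' N' (tmap f g v)"
      unfolding MN'.calR_eq by (rule MN.calR_transport) (simp_all add: EF)
    have qHH: "qHH bs M' N' (tmap f g v) = tmap f g (qHH bs M N v)" for v
      unfolding qHH_eq_diag
      by (rule diag_tmap_intertwine) (use f g in \<open>auto simp: osp_hom_def\<close>)
    have C: "\<forall>v. C_op (par M') (par N') (XE M') (XE N') (tmap f g v)
        = tmap f g (C_op (par M) (par N) (XE M) (XE N) v)"
      by (rule tens_ext_all; simp add: clinear_map_iff MN.C_tens MN'.C_tens)
    have "tmap f g (R_matrix bs M N v) = R_matrix bs M' N' (tmap f g v)"
      by (simp add: R_matrix_def Q_op_def R[symmetric] qHH C)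
    then have "super_tensor (par M) (par N) (par N') f g (R_matrix bs M N v)
      = R_matrix bs M' N' (super_tensor (par M) (par N) (par N') f g v)"
      by (simp add: super_tensor_even even)
  }
  then show ?thesis by (simp add: natural_at_def fun_eq_iff)
qed

section \<open>q-exponentials and embeddings in threefold tensor products\<close>

lemma qexp_transport:
  assumes "locally_nilpotent X" "clinear_map X" "clinear_map T" "\<And>v. T (X v) = Y (T v)"
  shows "T (qexp p X v) = qexp p Y (T v)"
  unfolding qexp_eq_ser by (rule ser_transport[OF assms])

lemma clinear_qexp:
  assumes "locally_nilpotent X" "clinear_map X"
  shows "clinear_map (qexp p X)"
  unfolding qexp_eq_ser by (rule clinear_ser[OF assms])

text \<open>For fixed \<open>w\<close> the map \<open>v \<mapsto> v \<otimes> w\<close> carries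
  \<open>X\<close> to \<open>X \<otimes> 1\<close>, so transport applies; similarly on the other
  side.\<close>

lemma tmap_qexp:
  assumes "locally_nilpotent X" "clinear_map X"
  shows "tmap (qexp p X) id = qexp p (tmap X id)" "tmap id (qexp p X) = qexp p (tmap id X)"
proof -
  have lin: "clinear_map (qexp p (tmap X id))" "clinear_map (qexp p (tmap id X))"
    by (simp_all add: clinear_qexp locally_nilpotent_tmap assms)
  show "tmap (qexp p X) id = qexp p (tmap X id)"
  proof (rule tens_ext)
    fix v w
    show "tmap (qexp p X) id (tens v w) = qexp p (tmap X id) (tens v w)"
      using qexp_transport[OF assms clinear_tens_left, of w "tmap X id" p v]
      by (simp add: assms clinear_qexp)
  qed (simp_all add: lin)
  show "tmap id (qexp p X) = qexp p (tmap id X)"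
  proof (rule tens_ext)
    fix v w
    show "tmap id (qexp p X) (tens v w) = qexp p (tmap id X) (tens v w)"
      using qexp_transport[OF assms clinear_tens_right, of v "tmap id X" p w]
      by (simp add: assms clinear_qexp)
  qed (simp_all add: lin)
qed

lemma qexp_conj:
  assumes "locally_nilpotent X" "clinear_map X" "clinear_map S" "\<And>v. S' (S v) = v" "\<And>v. S (S' v) =
      v"
  shows "S \<circ> qexp p X \<circ> S' = qexp p (S \<circ> X \<circ> S')"
proof
  fix v
  show "(S \<circ> qexp p X \<circ> S') v = qexp p (S \<circ> X \<circ> S') v"
    using qexp_transport[OF assms(1-3), of "S \<circ> X \<circ> S'" p "S' v"] assms(4,5) by simp
qed

lemma locally_nilpotent_conj:
  assumes "locally_nilpotent X" "clinear_map S" "\<And>v. S' (S v) = v" "\<And>v. S (S' v) = v"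
  shows "locally_nilpotent (S \<circ> X \<circ> S')"
  using assms(1)
  by (rule locally_nilpotent_transport[where T = S]) (simp_all add: assms surjI[of S S'])

lemma on12_eq: "on12 L M N T = assoc \<circ> tmap T id \<circ> assoc_inv"
  by (simp add: on12_def super_tensor_even[OF even_map_id])

lemma on23_eq:
  "even_map (\<lambda>(j, k). par M j \<noteq> par N k) (\<lambda>(j, k). par M j \<noteq> par N k) T \<Longrightarrow> on23 L M N T = tmap id T"
  by (simp only: on23_def super_tensor_even)

lemma flip23_eq: "flip23 L M N = tmap id (super_flip (par M) (par N))"
proof -
  have "even_map (\<lambda>(j, k). par M j \<noteq> par N k) (\<lambda>(k, j). par N k \<noteq> par M j) (super_flip (par M)
      (par N))"
    by (auto simp: even_map_def super_flip_basis_vec in_keys_iff lookup_cscale lookup_basis_vec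
        split: if_splits)
  then show ?thesis by (simp only: flip23_def super_tensor_even)
qed

lemma clinear_on [simp]: "clinear_map (flip23 L M N)" "clinear_map (on12 L M N T)" "clinear_map
    (on13 L M N T')"
  by (simp_all add: flip23_eq on12_eq on13_def)

lemmas on_simps [simp] = clinear_map_simps[OF clinear_on(1)] clinear_map_simps[OF clinear_on(2)]
  clinear_map_simps[OF clinear_on(3)]

lemma flip23_flip23 [simp]: "flip23 L N M (flip23 L M N v) = v"
proof -
  have "super_flip (par N) (par M) \<circ> super_flip (par M) (par N) = id" by (simp add: fun_eq_iff)
  then show ?thesis by (simp add: flip23_eq tmap_comp)
qed

lemma on12_comp:
  assumes "clinear_map S" "clinear_map T"
  shows "on12 L M N (S \<circ> T) = on12 L M N S \<circ> on12 L M N T"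
  by (simp add: on12_eq fun_eq_iff tmap_comp assms)

lemma on13_comp:
  assumes "clinear_map S" "clinear_map T"
  shows "on13 L M N (S \<circ> T) = on13 L M N S \<circ> on13 L M N T"
  by (simp add: on13_def fun_eq_iff on12_comp assms)

lemma on12_qexp:
  assumes "locally_nilpotent X" "clinear_map X"
  shows "on12 L M N (qexp p X) = qexp p (on12 L M N X)"
  unfolding on12_eq tmap_qexp[OF assms]
  by (rule qexp_conj) (simp_all add: locally_nilpotent_tmap assms)

lemma on13_qexp:
  assumes "locally_nilpotent X" "clinear_map X"
  shows "on13 L M N (qexp p X) = qexp p (on13 L M N X)"
  unfolding on13_def on12_qexp[OF assms]
  by (rule qexp_conj)
     (simp_all add: on12_eq locally_nilpotent_conj locally_nilpotent_tmap assms)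

lemma tmap_basis_vec: "tmap A B (basis_vec (i, j)) = tens (A (basis_vec i)) (B (basis_vec j))"
  by (simp add: tmap_def)

lemma assoc_basis_vec:
  "assoc (basis_vec ((i, j), k)) = basis_vec (i, j, k)"
  "assoc_inv (basis_vec (i, j, k)) = basis_vec ((i, j), k)"
  by (simp_all add: assoc_def assoc_inv_def)

section \<open>The coproduct axioms on three modules\<close>

locale osp_weight3 = LM: osp_weight2 b bs L M + LN: osp_weight2 b bs L N + MN: osp_weight2 b bs M N
  for b bs and L :: "'l osp_module" and M :: "'m osp_module" and N :: "'n osp_module"
begin

sublocale LM_N: osp_weight2 b bs "tensor_module bs L M" N
  by (intro osp_weight2.intro osp_weight_tensor) unfold_locales

sublocale L_MN: osp_weight2 b bs L "tensor_module bs M N"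
  by (intro osp_weight2.intro osp_weight_tensor) unfold_locales

abbreviation qHH13 :: "('l \<times> 'm \<times> 'n) vec \<Rightarrow> ('l \<times> 'm \<times> 'n) vec" where
  "qHH13 \<equiv> diag (\<lambda>(i, j, k). qpow bs (wt L i * wt N k / 2))"

lemma on13_qHH: "on13 L M N (qHH bs L N) = qHH13"
  by (rule clinear_map_basis_ext)
     (auto simp: on13_def flip23_eq on12_eq super_flip_basis_vec qHH_eq_diag tens_basis_vec
       tmap_basis_vec assoc_basis_vec)

lemma on13_C_tens:
  "on13 L M N (C_op (par L) (par N) (XE L) (XE N)) (tens u (tens v w)) =
    cscale (1/2) (tens u (tens v w) + cscale \<i> (tens (XE L u) (tens v w))
      + cscale \<i> (tens u (tens v (XE N w))) + tens (XE L u) (tens v (XE N w)))"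
  by (simp add: on13_def flip23_eq on12_eq super_flip_tens LN.C_tens)
     (rule vec_eqI, simp add: lookup_vec field_simps)

text \<open>On a fixed basis vector of \<open>L\<close> the operator is a power of
  \<open>q\<^sub>*^H\<close> on \<open>N\<close>. This reduces its commutation with \<open>C\<close>
  on the last two factors to that of \<open>C\<close> with \<open>qH\<close>.\<close>

lemma qHH13_basis_left: "qHH13 (tens (basis_vec i) y) = tens (basis_vec i) (tmap id (qH bs (wt N)
    (wt L i / 2)) y)"
proof (induction y rule: vec_basis_induct)
  case (basis x)
  show ?case
    by (cases x) (simp add: tens_basis_vec tmap_basis_vec assoc_basis_vec qH_eq_diag mult.commute)
qed simp_all

lemma qHH13_basis_right: "qHH13 (assoc (tens y (basis_vec k))) = assoc (tens (tmap (qH bs (wt L)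
    (wt N k / 2)) id y) (basis_vec k))"
proof (induction y rule: vec_basis_induct)
  case (basis x)
  show ?case
    by (cases x) (simp add: tens_basis_vec tmap_basis_vec assoc_basis_vec qH_eq_diag mult.commute)
qed simp_all

abbreviation (input) "CLM \<equiv> C_op (par L) (par M) (XE L) (XE M)"
abbreviation (input) "CLN \<equiv> C_op (par L) (par N) (XE L) (XE N)"
abbreviation (input) "CMN \<equiv> C_op (par M) (par N) (XE M) (XE N)"

lemma C_qH_commute:
  "CMN (tmap id (qH bs (wt N) s) y) = tmap id (qH bs (wt N) s) (CMN y)"
  "CLM (tmap (qH bs (wt L) s) id z) = tmap (qH bs (wt L) s) id (CLM z)"
  by (simp_all add: MN.C_even_even LM.C_even_even)

lemma qHH13_C23: "qHH13 (tmap id CMN v) = tmap id CMN (qHH13 v)"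
proof -
  have "qHH13 \<circ> tmap id CMN = tmap id CMN \<circ> qHH13"
  proof (rule clinear_map_basis_ext)
    fix x :: "'l \<times> 'm \<times> 'n"
    obtain i y where x: "basis_vec x = tens (basis_vec i) (basis_vec y)"
      by (cases x) (metis tens_basis_vec)
    show "(qHH13 \<circ> tmap id CMN) (basis_vec x) = (tmap id CMN \<circ> qHH13) (basis_vec x)"
      by (simp add: x qHH13_basis_left C_qH_commute)
  qed simp_all
  then show ?thesis by (simp add: fun_eq_iff)
qed

lemma qHH13_C12: "qHH13 (on12 L M N CLM v) = on12 L M N CLM (qHH13 v)"
proof -
  have "qHH13 \<circ> on12 L M N CLM = on12 L M N CLM \<circ> qHH13"
  proof (rule clinear_map_basis_ext)
    fix x :: "'l \<times> 'm \<times> 'n"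
    obtain y k where x: "basis_vec x = assoc (tens (basis_vec y) (basis_vec k))"
      by (cases x) (metis tens_basis_vec assoc_basis_vec(1))
    show "(qHH13 \<circ> on12 L M N CLM) (basis_vec x) = (on12 L M N CLM \<circ> qHH13) (basis_vec x)"
      by (simp add: x on12_eq qHH13_basis_right C_qH_commute)
  qed simp_all
  then show ?thesis by (simp add: fun_eq_iff)
qed

text \<open>The Cartan factor splits because \<open>H\<close> is primitive, and \<open>C\<close>
  splits because \<open>\<i> \<xi>\<eta>\<close> is group-like. The pieces are regrouped by moving
  \<open>qHH13\<close> past \<open>C\<close> on the last two factors.\<close>

lemma assoc_Q: "assoc (Q_op bs (tensor_module bs L M) N (assoc_inv v))
   = on13 L M N (Q_op bs L N) (tmap id (Q_op bs M N) v)"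
proof -
  let ?T = "tensor_module bs L M"
  have C: "assoc \<circ> C_op (par ?T) (par N) (XE ?T) (XE N) \<circ> assoc_inv = on13 L M N CLN \<circ> tmap id CMN"
    by (rule tens3_ext; simp add: LM_N.C_tens on13_C_tens MN.C_tens)
       (simp add: LM.tensor_XE,
        rule vec_eqI, simp add: lookup_vec field_simps)
  have D: "assoc \<circ> qHH bs ?T N \<circ> assoc_inv = qHH13 \<circ> tmap id (qHH bs M N)"
    by (rule clinear_map_basis_ext)
       (auto simp: assoc_basis_vec qHH_eq_diag tmap_basis_vec tens_basis_vec tensor_module_def
         algebra_simps add_divide_distrib simp flip: qpow_add)
  have "on13 L M N (Q_op bs L N) (tmap id (Q_op bs M N) v)
      = on13 L M N CLN (qHH13 (tmap id CMN (tmap id (qHH bs M N) v)))"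
    by (simp add: Q_op_def on13_comp on13_qHH tmap_comp)
  also have "\<dots> = (on13 L M N CLN \<circ> tmap id CMN) ((qHH13 \<circ> tmap id (qHH bs M N)) v)"
    by (simp add: qHH13_C23)
  also have "\<dots> = assoc (Q_op bs ?T N (assoc_inv v))"
    unfolding C[symmetric] D[symmetric] by (simp add: Q_op_def)
  finally show ?thesis ..
qed

lemma Q_L_MN: "Q_op bs L (tensor_module bs M N) v = on13 L M N (Q_op bs L N) (on12 L M N (Q_op bs
    L M) v)"
proof -
  let ?T = "tensor_module bs M N"
  have C: "C_op (par L) (par ?T) (XE L) (XE ?T) = on13 L M N CLN \<circ> on12 L M N CLM"
    by (rule tens3_ext; simp add: L_MN.C_tens on13_C_tens LM.C_tens on12_eq)
       (simp add: MN.tensor_XE,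
        rule vec_eqI, simp add: lookup_vec field_simps)
  have D: "qHH bs L ?T = qHH13 \<circ> on12 L M N (qHH bs L M)"
    by (rule clinear_map_basis_ext)
       (auto simp: on12_eq assoc_basis_vec qHH_eq_diag tmap_basis_vec tens_basis_vec
           tensor_module_def
         add_divide_distrib distrib_left qpow_add mult.commute)
  have "on13 L M N (Q_op bs L N) (on12 L M N (Q_op bs L M) v)
      = on13 L M N CLN (qHH13 (on12 L M N CLM (on12 L M N (qHH bs L M) v)))"
    by (simp add: Q_op_def on13_comp on13_qHH on12_comp)
  also have "\<dots> = (on13 L M N CLN \<circ> on12 L M N CLM) ((qHH13 \<circ> on12 L M N (qHH bs L M)) v)"
    by (simp add: qHH13_C12)
  also have "\<dots> = Q_op bs L ?T v"
    unfolding C[symmetric] D[symmetric] by (simp add: Q_op_def)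
  finally show ?thesis ..
qed

text \<open>The odd \<F> in the third place passes the middle factor, which therefore receives a
  \<sigma>.\<close>

lemma on13_EF_op: "on13 L M N (EF_op b L N) =
  (\<lambda>v. cscale (- (qpar b + inverse (qpar b))) (tmap (EE L \<circ> sg (par L)) (tmap (sg (par M)) (FF N))
      v))"
  by (rule tens3_ext; simp add: on13_def flip23_eq on12_eq super_flip_tens EF_op_def)
     (rule vec_eqI, simp add: lookup_vec field_simps)

lemma on12_calR: "on12 L M N (calR bs L M) = qexp LM.M.p (on12 L M N (EF_op b L M))"
  unfolding LM.calR_eq by (rule on12_qexp) (simp_all add: LM.nilpotent_EF_op)

lemma on13_calR: "on13 L M N (calR bs L N) = qexp LM.M.p (on13 L M N (EF_op b L N))"
  unfolding LN.calR_eq by (rule on13_qexp) (simp_all add: LN.nilpotent_EF_op)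

lemma tmap_id_calR: "tmap id (calR bs M N) = qexp LM.M.p (tmap id (EF_op b M N))"
  unfolding MN.calR_eq by (rule tmap_qexp) (simp_all add: MN.nilpotent_EF_op)

text \<open>With \<open>A\<close> and \<open>B\<close> from the two summands of the coproduct of
  \<E>, the claim is \<open>Q13 Q23 exp(A) exp(B) = Q13 exp(Y13) Q23 exp(Y23)\<close>; here
  \<open>B = Y23\<close> and \<open>Q23 A = Y13 Q23\<close>.\<close>

lemma coprod_id_R_matrix: "coprod_id_axiom L M N (R_matrix bs (tensor_module bs L M) N)
   (R_matrix bs L N) (R_matrix bs M N)"
proof -
  let ?T = "tensor_module bs L M"
  define c where "c = - (qpar b + inverse (qpar b))"
  \<comment> \<open>\<open>\<E> \<otimes> \<K>\<close> and \<open>\<sigma> \<otimes> \<E>\<close>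
    are multiplied by the parity operator \<open>\<sigma> \<otimes> \<sigma>\<close> of
    \<open>L \<otimes> M\<close>. In the second, the two \<sigma> on \<open>L\<close> cancel, so
    \<open>B\<close> acts as the identity there.\<close>
  define A where "A = (\<lambda>v. cscale c (tmap (EE L \<circ> sg (par L)) (tmap (KK bs M \<circ> sg (par M)) (FF N))
      v))"
  define B where "B = tmap (id :: 'l vec \<Rightarrow> 'l vec) (EF_op b M N)"
  have lin [simp]: "clinear_map A" "clinear_map B"
    by (simp_all add: A_def B_def)
  have nil: "locally_nilpotent A" "locally_nilpotent B"
    by (simp_all add: A_def B_def locally_nilpotent_cscale locally_nilpotent_tmap
        LM.M.nilpotent_EE_sg
        MN.nilpotent_EF_op)
  have BA: "B (A v) = cscale LM.M.p (A (B v))" for v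
  proof -
    have *: "clinear_map (\<lambda>v. cscale LM.M.p ((A \<circ> B) v))"
      by (rule clinear_map_cscale[OF clinear_map_comp[OF lin]])
    have "B \<circ> A = (\<lambda>v. cscale LM.M.p ((A \<circ> B) v))"
      by (rule tens3_ext[OF clinear_map_comp[OF lin(2,1)] *]; simp add: A_def B_def EF_op_def
          c_def mult.commute)
    then show ?thesis by (simp add: fun_eq_iff)
  qed
  have AB: "assoc \<circ> EF_op b ?T N \<circ> assoc_inv = (\<lambda>v. A v + B v)"
    by (rule tens3_ext; (simp add: clinear_map_iff vec.scale_right_distrib mult.commute; fail)?)
       (simp_all add: A_def B_def EF_op_def c_def LM.tensor_EE LM.tensor_par
           vec.scale_right_distrib)
  \<comment> \<open>On the last two factors \<open>Q\<close> removes \<K> from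
    \<open>\<K> \<sigma> \<otimes> \<F>\<close>, which leaves the exponent on the first and third
    factors.\<close>
  have QA: "tmap id (Q_op bs M N) (A v) = on13 L M N (EF_op b L N) (tmap id (Q_op bs M N) v)" for v
  proof -
    have "tmap (EE L \<circ> sg (par L)) (Q_op bs M N \<circ> tmap (KK bs M \<circ> sg (par M)) (FF N)) v
        = tmap (EE L \<circ> sg (par L)) (tmap (sg (par M)) (FF N) \<circ> Q_op bs M N) v"
      by (intro arg_cong2[of _ _ _ _ "\<lambda>x y. tmap x y v"]) (simp_all only: fun_eq_iff o_apply
          MN.Q_KKsg_F simp_thms)
    then show ?thesis
      unfolding on13_EF_op by (simp add: A_def c_def tmap_comp)
  qed
  have "assoc (R_matrix bs ?T N (assoc_inv v)) = on13 L M N (R_matrix bs L N) (on23 L M N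
      (R_matrix bs M N) v)" for v
  proof -
    have calR: "assoc (calR bs ?T N (assoc_inv v)) = qexp LM.M.p A (tmap id (calR bs M N) v)"
    proof -
      have "(assoc \<circ> calR bs ?T N \<circ> assoc_inv) v = qexp LM.M.p (\<lambda>v. A v + B v) v"
        unfolding LM_N.calR_eq AB[symmetric] by (subst qexp_conj) (simp_all add:
            LM_N.nilpotent_EF_op)
      also have "\<dots> = qexp LM.M.p A (qexp LM.M.p B v)"
        by (rule LM.M.qexp_add) (simp_all add: BA nil)
      also have "qexp LM.M.p B = tmap id (calR bs M N)"
        by (simp add: B_def tmap_id_calR)
      finally show ?thesis by simp
    qed
    have "assoc (R_matrix bs ?T N (assoc_inv v)) =
       on13 L M N (Q_op bs L N) (tmap id (Q_op bs M N) (qexp LM.M.p A (tmap id (calR bs M N) v)))"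
      by (simp add: R_matrix_apply calR[symmetric] flip: assoc_Q)
    also have "tmap id (Q_op bs M N) (qexp LM.M.p A (tmap id (calR bs M N) v))
       = qexp LM.M.p (on13 L M N (EF_op b L N)) (tmap id (Q_op bs M N) (tmap id (calR bs M N) v))"
      by (rule qexp_transport[OF nil(1) lin(1) clinear_tmap QA])
    also have "\<dots> = on13 L M N (calR bs L N) (on23 L M N (R_matrix bs M N) v)"
      unfolding on13_calR on23_eq[OF MN.even_R_matrix] by (simp add: R_matrix_def tmap_comp)
    also have "on13 L M N (Q_op bs L N) \<dots> = on13 L M N (R_matrix bs L N) (on23 L M N (R_matrix bs
        M N) v)"
      by (simp add: R_matrix_def on13_comp)
    finally show ?thesis .
  qed
  then show ?thesis
    by (simp add: coprod_id_axiom_def fun_eq_iff)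
qed

text \<open>Here the two summands of the coproduct of \<F> are used:
  \<open>\<K>^-1 \<otimes> \<F>\<close> gives \<open>A\<close>, and \<open>\<F> \<otimes> 1\<close>
  gives \<open>B = Y12\<close>. Conjugation by \<open>Q12\<close> carries \<open>A\<close> to
  \<open>Y13\<close>.\<close>

lemma id_coprod_R_matrix: "id_coprod_axiom L M N (R_matrix bs L (tensor_module bs M N))
   (R_matrix bs L N) (R_matrix bs L M)"
proof -
  let ?T = "tensor_module bs M N"
  define c where "c = - (qpar b + inverse (qpar b))"
  define A where "A = (\<lambda>v. cscale c (tmap (EE L \<circ> sg (par L)) (tmap (KK_inv bs M \<circ> sg (par M)) (FF
      N)) v))"
  define B where "B = (\<lambda>v. cscale c (tmap (EE L \<circ> sg (par L)) (tmap (FF M) (id :: 'n vec \<Rightarrow> 'n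
      vec)) v))"
  have lin [simp]: "clinear_map A" "clinear_map B"
    by (simp_all add: A_def B_def)
  have nil: "locally_nilpotent A" "locally_nilpotent B"
    by (simp_all add: A_def B_def locally_nilpotent_cscale locally_nilpotent_tmap
        LM.M.nilpotent_EE_sg)
  have BA: "B (A v) = cscale LM.M.p (A (B v))" for v
  proof -
    have *: "clinear_map (\<lambda>v. cscale LM.M.p ((A \<circ> B) v))"
      by (rule clinear_map_cscale[OF clinear_map_comp[OF lin]])
    have "B \<circ> A = (\<lambda>v. cscale LM.M.p ((A \<circ> B) v))"
      by (rule tens3_ext[OF clinear_map_comp[OF lin(2,1)] *]; simp add: A_def B_def mult.commute)
    then show ?thesis by (simp add: fun_eq_iff)
  qed
  have AB: "EF_op b L ?T = (\<lambda>v. A v + B v)"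
    by (rule tens3_ext; (simp add: clinear_map_iff vec.scale_right_distrib mult.commute; fail)?)
       (simp_all add: A_def B_def EF_op_def c_def MN.tensor_FF vec.scale_right_distrib add.commute)
  have B: "B = on12 L M N (EF_op b L M)"
    by (rule tens3_ext; (simp add: clinear_map_iff vec.scale_right_distrib mult.commute; fail)?)
       (simp_all add: B_def EF_op_def on12_eq c_def)
  \<comment> \<open>\<open>A\<close> is split into \<open>\<E> \<sigma> \<otimes> \<K>^-1\<close> on
    the first two factors and a part with \<open>1 \<otimes> \<sigma>\<close> there.
    \<open>Q\<close> removes \<open>\<K>^-1\<close> from the former and commutes with the
    latter.\<close>
  have QA: "on12 L M N (Q_op bs L M) (A v) = on13 L M N (EF_op b L N) (on12 L M N (Q_op bs L M)
      v)" for v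
  proof -
    let ?K = "KK_inv bs M \<circ> sg (par M)" and ?E = "EE L \<circ> sg (par L)"
    have A: "A = (\<lambda>v. cscale c (assoc (tmap (tmap ?E (KK_inv bs M)) id
        (tmap (tmap id (sg (par M))) (FF N) (assoc_inv v)))))"
      by (rule tens3_ext; (simp add: clinear_map_iff vec.scale_right_distrib mult.commute; fail)?)
         (simp_all add: A_def)
    have EF: "on13 L M N (EF_op b L N) = (\<lambda>v. cscale c (assoc (tmap (tmap ?E id) id
        (tmap (tmap id (sg (par M))) (FF N) (assoc_inv v)))))"
      unfolding on13_EF_op c_def[symmetric]
      by (rule tens3_ext; (simp add: clinear_map_iff vec.scale_right_distrib mult.commute; fail)?)
    have Qsg: "tmap (Q_op bs L M) id (tmap (tmap id (sg (par M))) (FF N) w)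
       = tmap (tmap id (sg (par M))) (FF N) (tmap (Q_op bs L M) id w)" for w
      by (simp add: tmap_comp comp_def LM.Q_sg)
    have QE: "tmap (Q_op bs L M) (id :: 'n vec \<Rightarrow> _) (tmap (tmap ?E (KK_inv bs M)) id w)
       = tmap (tmap ?E id) id (tmap (Q_op bs L M) id w)" for w
      by (simp add: tmap_comp comp_def LM.Q_Esg_KK_inv[unfolded comp_def])
    show ?thesis
      unfolding A EF by (simp add: on12_eq Qsg QE)
  qed
  have "R_matrix bs L ?T v = on13 L M N (R_matrix bs L N) (on12 L M N (R_matrix bs L M) v)" for v
  proof -
    have calR: "calR bs L ?T v = qexp LM.M.p A (on12 L M N (calR bs L M) v)"
    proof -
      have "calR bs L ?T v = qexp LM.M.p (\<lambda>v. A v + B v) v"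
        unfolding L_MN.calR_eq AB[symmetric] ..
      also have "\<dots> = qexp LM.M.p A (qexp LM.M.p B v)"
        by (rule LM.M.qexp_add) (simp_all add: BA nil)
      also have "qexp LM.M.p B = on12 L M N (calR bs L M)"
        by (simp add: B on12_calR)
      finally show ?thesis .
    qed
    have "R_matrix bs L ?T v =
       on13 L M N (Q_op bs L N) (on12 L M N (Q_op bs L M) (qexp LM.M.p A (on12 L M N (calR bs L M)
           v)))"
      by (simp add: R_matrix_apply calR[symmetric] flip: Q_L_MN)
    also have "on12 L M N (Q_op bs L M) (qexp LM.M.p A (on12 L M N (calR bs L M) v))
       = qexp LM.M.p (on13 L M N (EF_op b L N)) (on12 L M N (Q_op bs L M) (on12 L M N (calR bs L
           M) v))"
      by (rule qexp_transport[OF nil(1) lin(1) clinear_on(2) QA])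
    also have "\<dots> = on13 L M N (calR bs L N) (on12 L M N (R_matrix bs L M) v)"
      by (simp add: on13_calR R_matrix_def on12_comp)
    also have "on13 L M N (Q_op bs L N) \<dots> = on13 L M N (R_matrix bs L N) (on12 L M N (R_matrix bs
        L M) v)"
      by (simp add: R_matrix_def on13_comp)
    finally show ?thesis .
  qed
  then show ?thesis
    by (simp add: id_coprod_axiom_def fun_eq_iff)
qed

end

theorem theorem2p6:
  fixes b bs q qs :: complex
    and V :: "'v sl2_module"
    and L :: "'l osp_module" and M :: "'m osp_module" and N :: "'n osp_module"
    and M' :: "'m1 osp_module" and N' :: "'n1 osp_module"
  assumes "b^2 = bs^2 + 1/2"
    and "q = qpar b" and "qs = qpar bs"
    and "\<And>n. n \<ge> 1 \<Longrightarrow> q ^ n \<noteq> 1"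
    and "sl2_weight_module bs V"
    and "osp_weight_module b bs L" and "osp_weight_module b bs M" and "osp_weight_module b bs N"
    and "osp_weight_module b bs M'" and "osp_weight_module b bs N'"
  shows
    "(osp_weight_module b bs (realization V) \<and> osp_weight_module b bs (tensor_module bs M N))
     \<and> (\<forall>\<epsilon>1 \<epsilon>2. C_op id id (cliff_xi \<circ> cliff_eta) (cliff_xi \<circ> cliff_eta) (basis_vec (\<epsilon>1, \<epsilon>2))
          = cscale ((- 1) ^ (of_bool \<epsilon>1 * of_bool \<epsilon>2)) (basis_vec (\<epsilon>1, \<epsilon>2)))
     \<and> (\<forall>v. finite {n. (stensor M N (EE M) (FF N) ^^ n) v \<noteq> 0}
          \<and> finite {n. stensor M N (EE M ^^ n) (FF N ^^ n) v \<noteq> 0})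
     \<and> qexp (inverse (qs^2))
          (\<lambda>v. cscale (\<i> * (inverse qs - qs)) (stensor M N (EE M) (FF N) v))
        = qexp (- inverse (q^2))
          (\<lambda>v. cscale (- (q + inverse q)) (stensor M N (EE M) (FF N) v))
     \<and> calR bs M N = R_series b M N
     \<and> (invertible_even M N (R_matrix bs M N)
         \<and> natural_at M N M' N' (R_matrix bs M N) (R_matrix bs M' N')
         \<and> intertwines_coprod bs M N (R_matrix bs M N)
         \<and> coprod_id_axiom L M N
             (R_matrix bs (tensor_module bs L M) N) (R_matrix bs L N) (R_matrix bs M N)
         \<and> id_coprod_axiom L M N
             (R_matrix bs L (tensor_module bs M N)) (R_matrix bs L N) (R_matrix bs L M))"
proof -
  interpret osp_params b bs
    using assms(1,2,4) by unfold_locales auto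
  have weight: "osp_weight b bs L" "osp_weight b bs M" "osp_weight b bs N"
    "osp_weight b bs M'" "osp_weight b bs N'"
    using assms(6-10) by (simp_all add: osp_weight_def osp_weight_axioms_def osp_params_axioms)
  interpret osp_weight3 b bs L M N
    by (intro osp_weight3.intro osp_weight2.intro weight)
  have finite: "finite {n. (stensor M N (EE M) (FF N) ^^ n) v \<noteq> 0}
      \<and> finite {n. stensor M N (EE M ^^ n) (FF N ^^ n) v \<noteq> 0}" for v
  proof -
    \<comment> \<open>Up to signs both families consist of the powers of one locally nilpotent
      operator.\<close>
    obtain k where k: "\<And>n. n \<ge> k \<Longrightarrow> (tmap (EE M \<circ> sg (par M)) (FF N) ^^ n) v = 0"
      using locally_nilpotentD1[OF MN.nilpotent_EF_tmap clinear_tmap] by blast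
    have "{n. (tmap (EE M \<circ> sg (par M)) (FF N) ^^ n) v \<noteq> 0} \<subseteq> {..<k}"
      using k by (auto simp: not_less[symmetric])
    then have "finite {n. (tmap (EE M \<circ> sg (par M)) (FF N) ^^ n) v \<noteq> 0}"
      by (rule finite_subset) simp
    then show ?thesis
      by (simp add: super_tensor_odd[OF LN.N.odd_FF] stensor_funpow[OF weight(2,3)])
  qed
  have qexp: "qexp (inverse (qs^2))
          (\<lambda>v. cscale (\<i> * (inverse qs - qs)) (stensor M N (EE M) (FF N) v))
        = qexp (- inverse (q^2))
          (\<lambda>v. cscale (- (q + inverse q)) (stensor M N (EE M) (FF N) v))"
    unfolding assms(2,3) MN.EF_op_eq MN.EF_op_eq' MN.inverse_qpar_bs ..
  show ?thesis
    using osp_weight_module_realization[OF assms(5)] MN.osp_weight_module_tensor C_op_cliff finite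
        qexp
      MN.calR_eq_R_series MN.invertible_even_R_matrix natural_at_R_matrix[OF weight(2-5)]
      MN.intertwines_coprod_R_matrix coprod_id_R_matrix id_coprod_R_matrix
    by blast
qed

end
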